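(* Let $n\ge1$ and let $q\in\mathbb C$ be generic. In the quantum coordinate ring $\mathcal A_{q,-q^{-1}}(2n)$ with generator matrix $A=(a_{ij})_{1\le i,j\le 2n}$ one has $$\mathrm{Hf}_q\big(A\,\mathbb J_q\,A^T\big)=\mathrm{per}_q(A),$$ where $A\mathbb J_qA^T=B'=(b'_{ij})$ is given, for $i<j$, by $$b'_{ij}=\sum_{m=1}^n\mathrm{per}_q\big(A^{i,j}_{2m-1,2m}\big)=\sum_{m=1}^n\big(a_{i,2m-1}\,a_{j,2m}+q\,a_{j,2m-1}\,a_{i,2m}\big).$$
   Context: Generic means: $q$ is nonzero and not a root of unity. $\mathcal A_{q,-q^{-1}}(N)$ is the unital associative $\mathbb C$-algebra generated by $a_{ij}$, $1\le i,j\le N$, subject to the following relations with $r=q$, $s=-q^{-1}$, for all $i<j$ and $k<l$ (the first for every row $i$, the second for every column $k$): $a_{ik}a_{il}=r\,a_{il}a_{ik}$; $a_{ik}a_{jk}=s^{-1}a_{jk}a_{ik}$; $r\,a_{il}a_{jk}=s^{-1}a_{jk}a_{il}$; $a_{ik}a_{jl}-a_{jl}a_{ik}=(r-s)a_{il}a_{jk}$. The quantum (column) permanent of an $N\times N$ matrix is $\mathrm{per}_q(A)=\sum_{\sigma\in S_N}q^{l(\sigma)}a_{\sigma(1),1}a_{\sigma(2),2}\cdots a_{\sigma(N),N}$, where $l(\sigma)$ is the number of inversions of $\sigma$; $A^{i,j}_{k,l}$ denotes the $2\times 2$ submatrix with rows $i,j$ and columns $k,l$. $\mathbb J_v$ is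 the $2n\times 2n$ block-diagonal matrix $\mathrm{diag}(J_v,\dots,J_v)$ with $n$ blocks $J_v=\begin{pmatrix}0&1\\-v&0\end{pmatrix}$. For a $2n\times 2n$ matrix $B=(b_{ij})$ with entries in an associative $\mathbb C$-algebra, the quantum Hafnian is $$\mathrm{Hf}_q(B)=\frac1{[n]_{q^4}!}\sum_{\sigma\in\Pi'}q^{l(\sigma)}b_{\sigma(1)\sigma(2)}b_{\sigma(3)\sigma(4)}\cdots b_{\sigma(2n-1)\sigma(2n)},$$ where $\Pi'$ is the set of $\sigma\in S_{2n}$ with $\sigma(2i-1)<\sigma(2i)$ for $i=1,\dots,n$, and $[n]_u!=[n]_u\cdots[1]_u$, $[k]_u=1+u+\cdots+u^{k-1}$. *)

theory Defs
  imports
    Complex_Main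
    "HOL-Library.Poly_Mapping"
    "HOL-Combinatorics.Permutations"
    "HOL-Algebra.QuotRing"
    "HOL-Algebra.Module"
begin

section \<open>The free algebra on the letters \<open>a\<^sub>i\<^sub>j\<close>\<close>

text \<open>
  The wrapper type makes words a (non-commutative) additive monoid under concatenation, so that
  the convolution product on finitely supported functions from words to scalars is the product of
  the free associative algebra.
\<close>

datatype 'a fword = FWord (letters: "'a list")

instantiation fword :: (type) monoid_add
begin

definition zero_fword :: "'a fword" where
  "0 = FWord []"

definition plus_fword :: "'a fword \<Rightarrow> 'a fword \<Rightarrow> 'a fword" where
  "u + v = FWord (letters u @ letters v)"

instance
  by standard (simp_all add: zero_fword_def plus_fword_def)

end

type_synonym falg = "(nat \<times> nat) fword \<Rightarrow>\<^sub>0 complex"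

text \<open>Rows and columns are numbered from \<open>1\<close> to \<open>N\<close>.\<close>

definition free_algebra :: "nat \<Rightarrow> (complex, falg) module" where
  "free_algebra N =
    \<lparr>carrier = {f. \<forall>w \<in> Poly_Mapping.keys f. set (letters w) \<subseteq> {1..N} \<times> {1..N}},
     monoid.mult = (*), one = 1, zero = 0, add = (+),
     smult = (\<lambda>c f. Poly_Mapping.single 0 c * f)\<rparr>"

definition letter :: "nat \<Rightarrow> nat \<Rightarrow> falg" where
  "letter i j = Poly_Mapping.single (FWord [(i, j)]) 1"


section \<open>The two-parameter quantum coordinate ring\<close>

text \<open>Each defining relation \<open>x = y\<close> is recorded as the element \<open>x - y\<close>.\<close>

definition qrelations :: "complex \<Rightarrow> complex \<Rightarrow> nat \<Rightarrow> falg set" where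
  "qrelations r s N =
    (let a = letter; C = (\<lambda>c. Poly_Mapping.single 0 c :: falg) in
     {a i k * a i l - C r * (a i l * a i k)
        | i k l. i \<in> {1..N} \<and> k \<in> {1..N} \<and> l \<in> {1..N} \<and> k < l}
   \<union> {a i k * a j k - C (inverse s) * (a j k * a i k)
        | i j k. i \<in> {1..N} \<and> j \<in> {1..N} \<and> k \<in> {1..N} \<and> i < j}
   \<union> {C r * (a i l * a j k) - C (inverse s) * (a j k * a i l)
        | i j k l. i \<in> {1..N} \<and> j \<in> {1..N} \<and> k \<in> {1..N} \<and> l \<in> {1..N} \<and> i < j \<and> k < l}
   \<union> {(a i k * a j l - a j l * a i k) - C (r - s) * (a i l * a j k)
        | i j k l. i \<in> {1..N} \<and> j \<in> {1..N} \<and> k \<in> {1..N} \<and> l \<in> {1..N} \<and> i < j \<and> k < l})"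

definition qideal :: "complex \<Rightarrow> complex \<Rightarrow> nat \<Rightarrow> falg set" where
  "qideal r s N = genideal (free_algebra N) (qrelations r s N)"

definition qcoord :: "complex \<Rightarrow> complex \<Rightarrow> nat \<Rightarrow> (complex, falg set) module" where
  "qcoord r s N =
    ring.extend (free_algebra N Quot qideal r s N)
      \<lparr>smult = (\<lambda>c X. \<Union>x\<in>X.
          qideal r s N +>\<^bsub>free_algebra N\<^esub> (c \<odot>\<^bsub>free_algebra N\<^esub> x))\<rparr>"

definition qgen :: "complex \<Rightarrow> complex \<Rightarrow> nat \<Rightarrow> nat \<Rightarrow> nat \<Rightarrow> falg set" where
  "qgen r s N = (\<lambda>i j. qideal r s N +>\<^bsub>free_algebra N\<^esub> letter i j)"


section \<open>Matrices, permanents and Hafnians over an associative algebra\<close>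

text \<open>
  A matrix is a function of two indices, of which only the values at indices from \<open>1\<close> up to the
  size matter.  The algebra is a record \<open>M\<close>, not assumed commutative.
\<close>

definition mat_prod ::
  "('c, 'a, 'm) module_scheme \<Rightarrow> nat \<Rightarrow> (nat \<Rightarrow> nat \<Rightarrow> 'a) \<Rightarrow> (nat \<Rightarrow> nat \<Rightarrow> 'a) \<Rightarrow> nat \<Rightarrow> nat \<Rightarrow> 'a"
where
  "mat_prod M d X Y = (\<lambda>i j. \<Oplus>\<^bsub>M\<^esub>k\<in>{1..d}. X i k \<otimes>\<^bsub>M\<^esub> Y k j)"

definition mat_transpose :: "(nat \<Rightarrow> nat \<Rightarrow> 'a) \<Rightarrow> nat \<Rightarrow> nat \<Rightarrow> 'a" where
  "mat_transpose X = (\<lambda>i j. X j i)"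

definition scalar_mat ::
  "('c, 'a, 'm) module_scheme \<Rightarrow> (nat \<Rightarrow> nat \<Rightarrow> 'c) \<Rightarrow> nat \<Rightarrow> nat \<Rightarrow> 'a"
where
  "scalar_mat M S = (\<lambda>i j. S i j \<odot>\<^bsub>M\<^esub> \<one>\<^bsub>M\<^esub>)"

definition submatrix2 ::
  "(nat \<Rightarrow> nat \<Rightarrow> 'a) \<Rightarrow> nat \<Rightarrow> nat \<Rightarrow> nat \<Rightarrow> nat \<Rightarrow> nat \<Rightarrow> nat \<Rightarrow> 'a"
where
  "submatrix2 X i j k l = (\<lambda>a b. X (if a = 1 then i else j) (if b = 1 then k else l))"

text \<open>
  The block-diagonal matrix with \<open>2 \<times> 2\<close> blocks \<open>(0, 1; -v, 0)\<close>: the \<open>m\<close>-th block occupies the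
  rows and columns \<open>2 * m - 1\<close> and \<open>2 * m\<close>.
\<close>

definition JJ :: "complex \<Rightarrow> nat \<Rightarrow> nat \<Rightarrow> complex" where
  "JJ v = (\<lambda>i j. if odd i \<and> j = i + 1 then 1 else if odd j \<and> i = j + 1 then - v else 0)"

definition ordered_prod :: "('a, 'm) monoid_scheme \<Rightarrow> 'a list \<Rightarrow> 'a" where
  "ordered_prod M xs = foldr (\<otimes>\<^bsub>M\<^esub>) xs \<one>\<^bsub>M\<^esub>"

definition inv_number :: "nat \<Rightarrow> (nat \<Rightarrow> nat) \<Rightarrow> nat" where
  "inv_number N \<sigma> = card {(i, j). 1 \<le> i \<and> i < j \<and> j \<le> N \<and> \<sigma> j < \<sigma> i}"

definition qper ::
  "(complex, 'a, 'm) module_scheme \<Rightarrow> complex \<Rightarrow> nat \<Rightarrow> (nat \<Rightarrow> nat \<Rightarrow> 'a) \<Rightarrow> 'a"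
where
  "qper M q N X =
    (\<Oplus>\<^bsub>M\<^esub>\<sigma>\<in>{\<sigma>. \<sigma> permutes {1..N}}.
       q ^ inv_number N \<sigma> \<odot>\<^bsub>M\<^esub> ordered_prod M (map (\<lambda>k. X (\<sigma> k) k) [1..<N + 1]))"

definition qint :: "complex \<Rightarrow> nat \<Rightarrow> complex" where
  "qint u k = (\<Sum>i<k. u ^ i)"

definition qfact :: "complex \<Rightarrow> nat \<Rightarrow> complex" where
  "qfact u n = (\<Prod>k=1..n. qint u k)"

definition qHf ::
  "(complex, 'a, 'm) module_scheme \<Rightarrow> complex \<Rightarrow> nat \<Rightarrow> (nat \<Rightarrow> nat \<Rightarrow> 'a) \<Rightarrow> 'a"
where
  "qHf M q n X =
    (1 / qfact (q ^ 4) n) \<odot>\<^bsub>M\<^esub>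
      (\<Oplus>\<^bsub>M\<^esub>\<sigma>\<in>{\<sigma>. \<sigma> permutes {1..2 * n} \<and> (\<forall>i\<in>{1..n}. \<sigma> (2 * i - 1) < \<sigma> (2 * i))}.
         q ^ inv_number (2 * n) \<sigma> \<odot>\<^bsub>M\<^esub>
           ordered_prod M (map (\<lambda>i. X (\<sigma> (2 * i - 1)) (\<sigma> (2 * i))) [1..<n + 1]))"

definition generic :: "complex \<Rightarrow> bool" where
  "generic q \<longleftrightarrow> q \<noteq> 0 \<and> (\<forall>k>0. q ^ k \<noteq> 1)"


section \<open>Well-definedness of the quantum coordinate ring\<close>

lemma free_algebra_simps [simp]:
  "monoid.mult (free_algebra N) = (*)" "one (free_algebra N) = 1"
  "zero (free_algebra N) = 0" "add (free_algebra N) = (+)"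
  "smult (free_algebra N) = (\<lambda>c f. Poly_Mapping.single 0 c * f)"
  by (simp_all add: free_algebra_def)

lemma in_free_algebra:
  "f \<in> carrier (free_algebra N) \<longleftrightarrow>
    (\<forall>w \<in> Poly_Mapping.keys f. set (letters w) \<subseteq> {1..N} \<times> {1..N})"
  by (simp add: free_algebra_def)

lemma free_algebra_closed:
  assumes "f \<in> carrier (free_algebra N)" "g \<in> carrier (free_algebra N)"
  shows "f + g \<in> carrier (free_algebra N)" "f * g \<in> carrier (free_algebra N)"
    "f - g \<in> carrier (free_algebra N)" "- f \<in> carrier (free_algebra N)"
proof -
  show "f + g \<in> carrier (free_algebra N)"
    using assms keys_add[of f g] unfolding in_free_algebra by blast
  show "f - g \<in> carrier (free_algebra N)"
    using assms keys_diff[of f g] unfolding in_free_algebra by blast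
  show "- f \<in> carrier (free_algebra N)"
    using assms unfolding in_free_algebra by simp
  show "f * g \<in> carrier (free_algebra N)"
    unfolding in_free_algebra
  proof
    fix w assume "w \<in> Poly_Mapping.keys (f * g)"
    then obtain u v where "w = u + v" "u \<in> Poly_Mapping.keys f" "v \<in> Poly_Mapping.keys g"
      using keys_mult[of f g] by blast
    then show "set (letters w) \<subseteq> {1..N} \<times> {1..N}"
      using assms unfolding in_free_algebra by (auto simp: plus_fword_def)
  qed
qed

lemma scalar_in_free_algebra: "Poly_Mapping.single 0 c \<in> carrier (free_algebra N)"
  by (simp add: in_free_algebra zero_fword_def)

lemma letter_in_free_algebra:
  "i \<in> {1..N} \<Longrightarrow> j \<in> {1..N} \<Longrightarrow> letter i j \<in> carrier (free_algebra N)"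
  by (simp add: in_free_algebra letter_def)

lemma ring_free_algebra: "ring (free_algebra N)"
proof (rule ringI)
  have one: "1 \<in> carrier (free_algebra N)" and zero: "0 \<in> carrier (free_algebra N)"
    using scalar_in_free_algebra[of 1 N] scalar_in_free_algebra[of 0 N] by simp_all
  show "abelian_group (free_algebra N)"
  proof (rule abelian_groupI)
    fix x assume "x \<in> carrier (free_algebra N)"
    then show "\<exists>y\<in>carrier (free_algebra N). y \<oplus>\<^bsub>free_algebra N\<^esub> x = \<zero>\<^bsub>free_algebra N\<^esub>"
      by (intro bexI[of _ "- x"]) (simp_all add: free_algebra_closed)
  qed (simp_all add: free_algebra_closed zero add.assoc add.commute)
  show "Group.monoid (free_algebra N)"
    by (rule monoidI) (simp_all add: free_algebra_closed one mult.assoc)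
qed (simp_all add: distrib_right distrib_left)

lemma qrelations_subset: "qrelations r s N \<subseteq> carrier (free_algebra N)"
  unfolding qrelations_def Let_def
  by (auto simp: free_algebra_closed letter_in_free_algebra scalar_in_free_algebra)

lemma ideal_qideal: "ideal (qideal r s N) (free_algebra N)"
  unfolding qideal_def
  by (rule ring.genideal_ideal[OF ring_free_algebra qrelations_subset])

lemma qcoord_simps:
  "carrier (qcoord r s N) = carrier (free_algebra N Quot qideal r s N)"
  "monoid.mult (qcoord r s N) = monoid.mult (free_algebra N Quot qideal r s N)"
  "one (qcoord r s N) = one (free_algebra N Quot qideal r s N)"
  "zero (qcoord r s N) = zero (free_algebra N Quot qideal r s N)"
  "add (qcoord r s N) = add (free_algebra N Quot qideal r s N)"
  by (simp_all add: qcoord_def ring.defs)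

lemma ring_qcoord: "ring (qcoord r s N)"
proof -
  interpret Q: ring "free_algebra N Quot qideal r s N"
    by (rule ideal.quotient_is_ring[OF ideal_qideal])
  show ?thesis
  proof (rule ringI)
    show "abelian_group (qcoord r s N)"
    proof (rule abelian_groupI)
      fix x assume "x \<in> carrier (qcoord r s N)"
      then show "\<exists>y\<in>carrier (qcoord r s N). y \<oplus>\<^bsub>qcoord r s N\<^esub> x = \<zero>\<^bsub>qcoord r s N\<^esub>"
        unfolding qcoord_simps
        by (intro bexI[of _ "\<ominus>\<^bsub>free_algebra N Quot qideal r s N\<^esub> x"]
            Q.l_neg Q.a_inv_closed)
    qed (unfold qcoord_simps,
        (rule Q.add.m_closed Q.zero_closed Q.a_assoc Q.a_comm Q.l_zero; assumption)+)
    show "Group.monoid (qcoord r s N)"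
      by (rule monoidI) (simp_all add: qcoord_simps Q.m_assoc)
  qed (simp_all add: qcoord_simps Q.l_distr Q.r_distr)
qed

lemma qcoord_smult_coset:
  assumes "f \<in> carrier (free_algebra N)"
  shows "c \<odot>\<^bsub>qcoord r s N\<^esub> (qideal r s N +>\<^bsub>free_algebra N\<^esub> f) =
    qideal r s N +>\<^bsub>free_algebra N\<^esub> (c \<odot>\<^bsub>free_algebra N\<^esub> f)"
proof -
  interpret ideal "qideal r s N" "free_algebra N" by (rule ideal_qideal)
  let ?I = "qideal r s N"
  have *: "?I +>\<^bsub>free_algebra N\<^esub> (c \<odot>\<^bsub>free_algebra N\<^esub> x) =
      ?I +>\<^bsub>free_algebra N\<^esub> (c \<odot>\<^bsub>free_algebra N\<^esub> f)"
    if x: "x \<in> ?I +>\<^bsub>free_algebra N\<^esub> f" for x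
  proof -
    obtain h where h: "h \<in> ?I" "x = h + f"
      using x by (auto simp: a_r_coset_def r_coset_def)
    let ?c = "Poly_Mapping.single 0 c :: falg"
    have ch: "?c * h \<in> ?I"
      using I_l_closed[OF h(1) scalar_in_free_algebra[of c N]] by simp
    have "?c * x \<in> ?I +>\<^bsub>free_algebra N\<^esub> (?c * f)"
      using ch h(2) by (auto simp: a_r_coset_def r_coset_def distrib_left)
    then show ?thesis
      using a_repr_independence'[OF _ free_algebra_closed(2)[OF scalar_in_free_algebra assms]]
      by simp
  qed
  have "f \<in> ?I +>\<^bsub>free_algebra N\<^esub> f"
    using assms by (rule a_rcos_self)
  then have "(\<Union>x\<in>?I +>\<^bsub>free_algebra N\<^esub> f.
        ?I +>\<^bsub>free_algebra N\<^esub> (c \<odot>\<^bsub>free_algebra N\<^esub> x)) =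
      ?I +>\<^bsub>free_algebra N\<^esub> (c \<odot>\<^bsub>free_algebra N\<^esub> f)"
    using * by blast
  then show ?thesis
    by (simp only: qcoord_def ring.defs module.simps)
qed

end

theory Submission
  imports Defs "HOL-Combinatorics.Multiset_Permutations"
begin

text \<open>
  For a word \<open>c\<^sub>1 \<dots> c\<^sub>N\<close> of columns let \<open>P(c)\<close> be the sum of
  \<open>q\<^bsup>l(\<sigma>)\<^esup> a\<^bsub>\<sigma>(1),c\<^sub>1\<^esub> \<dots> a\<^bsub>\<sigma>(N),c\<^sub>N\<^esub>\<close> over all \<open>\<sigma>\<close>. Grouping \<open>\<sigma>\<close> with
  \<open>\<sigma> \<circ> (k k+1)\<close> and using the defining relations, \<open>P\<close> vanishes when two adjacent columns agree,
  and interchanging adjacent columns \<open>k < l\<close> into \<open>l, k\<close> multiplies it by \<open>q\<close>. The same grouping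
  turns the Hafnian sum of \<open>A J\<^sub>q A\<^sup>T\<close> into the sum of \<open>P(2m\<^sub>1-1, 2m\<^sub>1, \<dots>, 2m\<^sub>n-1, 2m\<^sub>n)\<close>
  over all \<open>m \<in> {1..n}\<^sup>n\<close>. Only permutations \<open>m\<close> contribute, and interchanging two pairs costs
  four interchanges of columns, so the total is the sum of \<open>q\<^bsup>4 l(m)\<^esup>\<close> times the permanent, that is
  \<open>[n]!\<close> at \<open>q\<^sup>4\<close> times the permanent.
\<close>

section \<open>Inversions and sums over permutations\<close>

text \<open>Transposing positions \<open>k\<close> and \<open>k + 1\<close> keeps the order of every
  other pair of positions. So the inversions of \<open>\<sigma>\<close> correspond bijectively to
  those of the composite, apart from the new inversion at \<open>(k, Suc k)\<close> itself.\<close>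

lemma inv_number_adjacent_swap:
  assumes \<sigma>: "\<sigma> permutes {1..N}" and k: "1 \<le> k" "k < N" and less: "\<sigma> k < \<sigma> (Suc k)"
  shows "inv_number N (\<sigma> \<circ> transpose k (Suc k)) = Suc (inv_number N \<sigma>)"
proof -
  let ?t = "transpose k (Suc k)"
  let ?I = "\<lambda>\<sigma>. {(i, j). 1 \<le> i \<and> i < j \<and> j \<le> N \<and> (\<sigma> :: nat \<Rightarrow> nat) j < \<sigma> i}"
  have fin: "finite (?I \<sigma>)"
    by (rule finite_subset[of _ "{1..N} \<times> {1..N}"]) auto
  have "?I (\<sigma> \<circ> ?t) = insert (k, Suc k) (map_prod ?t ?t ` ?I \<sigma>)"
  proof (intro equalityI subsetI)
    fix p assume "p \<in> ?I (\<sigma> \<circ> ?t)"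
    then obtain i j where p: "p = (i, j)" "1 \<le> i" "i < j" "j \<le> N" "\<sigma> (?t j) < \<sigma> (?t i)"
      by auto
    show "p \<in> insert (k, Suc k) (map_prod ?t ?t ` ?I \<sigma>)"
    proof (cases "p = (k, Suc k)")
      case False
      then have "1 \<le> ?t i" "?t i < ?t j" "?t j \<le> N"
        using p k by (auto simp: transpose_def)
      then have "(?t i, ?t j) \<in> ?I \<sigma>" using p by auto
      then have "map_prod ?t ?t (?t i, ?t j) \<in> map_prod ?t ?t ` ?I \<sigma>" by (rule imageI)
      then show ?thesis using p by simp
    qed simp
  next
    fix p assume "p \<in> insert (k, Suc k) (map_prod ?t ?t ` ?I \<sigma>)"
    then consider "p = (k, Suc k)"
      | i j where "p = (?t i, ?t j)" "1 \<le> i" "i < j" "j \<le> N" "\<sigma> j < \<sigma> i"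
      by auto
    then show "p \<in> ?I (\<sigma> \<circ> ?t)"
    proof cases
      case 1
      then show ?thesis using k less by simp
    next
      case 2
      \<comment> \<open>The pair \<open>(k, Suc k)\<close>, the only one whose order
        \<open>?t\<close> reverses, cannot be \<open>(i, j)\<close> here: by \<open>less\<close> it
        is not an inversion of \<open>\<sigma>\<close>.\<close>
      have "1 \<le> ?t i" "?t i < ?t j" "?t j \<le> N"
        using 2 k less by (auto simp: transpose_def)
      then show ?thesis using 2 by simp
    qed
  qed
  moreover have "(k, Suc k) \<notin> map_prod ?t ?t ` ?I \<sigma>"
  proof
    assume "(k, Suc k) \<in> map_prod ?t ?t ` ?I \<sigma>"
    then obtain i j where "i < j" "k = ?t i" "Suc k = ?t j" by auto
    then show False by (metis Suc_n_not_le_n less_imp_le transpose_apply_first transpose_apply_second transpose_involutory)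
  qed
  moreover have "inj (map_prod ?t ?t)"
    by (rule prod.inj_map) simp_all
  ultimately show ?thesis
    unfolding inv_number_def using fin by (simp add: card_image inj_on_subset)
qed

lemma inv_number_id [simp]: "inv_number N id = 0"
proof -
  have "{(i, j). 1 \<le> i \<and> i < j \<and> j \<le> N \<and> id j < id i} = {}" by auto
  then show ?thesis unfolding inv_number_def by (metis card.empty)
qed

text \<open>Composition with the transposition is an involution without fixed points, and each of
  its orbits has exactly one member increasing at \<open>k\<close>. The predicate \<open>Q\<close>
  leaves room for constraints at other positions, as in the Hafnian.\<close>

lemma sum_permutes_adjacent_split:
  fixes g :: "(nat \<Rightarrow> nat) \<Rightarrow> 'a :: comm_monoid_add"
  assumes k: "1 \<le> k" "k < N"
    and Q: "\<And>\<sigma>. Q (\<sigma> \<circ> transpose k (Suc k)) \<longleftrightarrow> Q \<sigma>"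
  shows "(\<Sum>\<sigma> | \<sigma> permutes {1..N} \<and> Q \<sigma>. g \<sigma>) =
    (\<Sum>\<sigma> | \<sigma> permutes {1..N} \<and> Q \<sigma> \<and> \<sigma> k < \<sigma> (Suc k). g \<sigma> + g (\<sigma> \<circ> transpose k (Suc k)))"
proof -
  let ?t = "transpose k (Suc k)"
  let ?A = "{\<sigma>. \<sigma> permutes {1..N} \<and> Q \<sigma> \<and> \<sigma> k < \<sigma> (Suc k)}"
  let ?B = "{\<sigma>. \<sigma> permutes {1..N} \<and> Q \<sigma> \<and> \<sigma> (Suc k) < \<sigma> k}"
  have t: "?t permutes {1..N}"
    using k by (intro permutes_swap_id) auto
  have fin: "finite ?A" "finite ?B"
    by (auto intro: finite_subset[OF _ finite_permutations[of "{1..N}"]])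
  have cases: "\<sigma> k < \<sigma> (Suc k) \<or> \<sigma> (Suc k) < \<sigma> k" if "\<sigma> permutes {1..N}" for \<sigma>
    using inj_eq[OF permutes_inj[OF that], of k "Suc k"] by linarith
  have "{\<sigma>. \<sigma> permutes {1..N} \<and> Q \<sigma>} = ?A \<union> ?B"
    by (auto simp del: One_nat_def dest: cases)
  then have "(\<Sum>\<sigma> | \<sigma> permutes {1..N} \<and> Q \<sigma>. g \<sigma>) = sum g ?A + sum g ?B"
    using fin by (simp add: sum.union_disjoint disjoint_iff)
  also have "sum g ?B = (\<Sum>\<sigma>\<in>?A. g (\<sigma> \<circ> ?t))"
  proof (rule sum.reindex_bij_witness[where i = "\<lambda>\<sigma>. \<sigma> \<circ> ?t" and j = "\<lambda>\<sigma>. \<sigma> \<circ> ?t"])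
    fix \<sigma> :: "nat \<Rightarrow> nat"
    show 1: "\<sigma> \<circ> ?t \<circ> ?t = \<sigma>" by (simp add: comp_assoc)
    show "\<sigma> \<circ> ?t \<circ> ?t = \<sigma>" by (fact 1)
    show "\<sigma> \<circ> ?t \<in> ?A" if "\<sigma> \<in> ?B"
      using that permutes_compose[OF t, of \<sigma>] Q[of \<sigma>] by (simp only: mem_Collect_eq) simp
    show "\<sigma> \<circ> ?t \<in> ?B" if "\<sigma> \<in> ?A"
      using that permutes_compose[OF t, of \<sigma>] Q[of \<sigma>] by (simp only: mem_Collect_eq) simp
    show "g (\<sigma> \<circ> ?t \<circ> ?t) = g \<sigma>" by (simp add: 1)
  qed
  finally show ?thesis by (simp add: sum.distrib)
qed

text \<open>Expanding the product means choosing one summand per factor. The choices are kept as a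
  word because the factors need not commute.\<close>

lemma prod_list_sum_distrib:
  fixes f :: "'i \<Rightarrow> 'b \<Rightarrow> 'a :: semiring_1"
  assumes "finite A"
  shows "prod_list (map (\<lambda>i. \<Sum>m\<in>A. f i m) is) =
    (\<Sum>w | set w \<subseteq> A \<and> length w = length is. prod_list (map2 f is w))"
proof (induction "is")
  case Nil
  have "{w. set w \<subseteq> A \<and> w = []} = {[]}" by auto
  then show ?case by simp
next
  case (Cons i "is")
  let ?W = "{w. set w \<subseteq> A \<and> length w = length is}"
  have "(\<Sum>w | set w \<subseteq> A \<and> length w = length (i # is). prod_list (map2 f (i # is) w)) =
      (\<Sum>(w, m)\<in>?W \<times> A. f i m * prod_list (map2 f is w))"
    by (simp add: lists_length_Suc_eq sum.reindex inj_on_def case_prod_unfold)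
  also have "\<dots> = (\<Sum>w\<in>?W. \<Sum>m\<in>A. f i m * prod_list (map2 f is w))"
    by (rule sum.cartesian_product[symmetric])
  also have "\<dots> = (\<Sum>m\<in>A. f i m) * (\<Sum>w\<in>?W. prod_list (map2 f is w))"
    by (subst sum.swap) (simp add: sum_product)
  finally show ?case using Cons.IH by simp
qed


section \<open>Word functions that are \<open>u\<close>-symmetric modulo a subspace\<close>

text \<open>Membership of \<open>x - c *s y\<close> in \<open>S\<close> is read as a congruence of
  \<open>x\<close> and \<open>c *s y\<close> modulo \<open>S\<close>. There are two instances, both
  with the ideal of relations as \<open>S\<close>: single columns with \<open>u = q\<close>, and
  pairs of columns with \<open>u = q ^ 4\<close>.\<close>

locale q_symmetric = vector_space scale
  for scale :: "complex \<Rightarrow> 'v :: ab_group_add \<Rightarrow> 'v" (infixr \<open>*s\<close> 75) +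
  fixes S :: "'v set" and u :: complex and F :: "'b :: linorder list \<Rightarrow> 'v"
  assumes S: "subspace S" and u_nonzero: "u \<noteq> 0"
    and swap: "k < l \<Longrightarrow> F (xs @ l # k # ys) - u *s F (xs @ k # l # ys) \<in> S"
    and rep: "F (xs @ k # k # ys) \<in> S"
begin

lemma congruent_trans:
  assumes "x - c *s y \<in> S" "y - d *s z \<in> S" shows "x - (c * d) *s z \<in> S"
proof -
  have "(x - c *s y) + c *s (y - d *s z) \<in> S"
    by (intro subspace_add[OF S] subspace_scale[OF S] assms)
  then show ?thesis by (simp add: scale_right_diff_distrib)
qed

lemma congruent_mem:
  assumes "x - c *s y \<in> S" "y \<in> S" shows "x \<in> S"
  using subspace_add[OF S assms(1) subspace_scale[OF S assms(2), of c]] by simp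

lemma congruent_mem':
  assumes "x - c *s y \<in> S" "x \<in> S" "c \<noteq> 0" shows "y \<in> S"
proof -
  have "y = inverse c *s (x - (x - c *s y))" using assms(3) by simp
  then show ?thesis using assms(1,2) S by (metis subspace_diff subspace_scale)
qed

text \<open>Induction on the gap between the two equal letters: exchanging the left one with its
  right neighbour shortens the gap and changes \<open>F\<close> only by the unit \<open>u\<close> or
  its inverse, modulo \<open>S\<close>.\<close>

lemma repeated_letter: "F (xs @ y # ys @ y # zs) \<in> S"
proof (induction ys arbitrary: xs)
  case Nil
  show ?case using rep by simp
next
  case (Cons z ys)
  have IH: "F (xs @ z # y # ys @ y # zs) \<in> S" using Cons.IH[of "xs @ [z]"] by simp
  consider "z < y" | "z = y" | "y < z" by fastforce
  then show ?case
  proof cases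
    case 1
    from congruent_mem[OF swap[OF 1] IH] show ?thesis by simp
  next
    case 2
    then show ?thesis using rep by simp
  next
    case 3
    from congruent_mem'[OF swap[OF 3] IH u_nonzero] show ?thesis by simp
  qed
qed

lemma not_distinct: "\<not> distinct w \<Longrightarrow> F w \<in> S"
  using not_distinct_decomp[of w] repeated_letter by fastforce

lemma move_right:
  assumes "\<forall>y\<in>set ys. y < x"
  shows "F (xs @ x # ys @ zs) - u ^ length ys *s F (xs @ ys @ x # zs) \<in> S"
  using assms
proof (induction ys arbitrary: xs)
  case Nil
  then show ?case using S by (simp add: subspace_0)
next
  case (Cons y ys)
  have "F (xs @ x # y # ys @ zs) - u *s F (xs @ y # x # ys @ zs) \<in> S"
    using Cons.prems by (intro swap) simp
  moreover have "F ((xs @ [y]) @ x # ys @ zs) - u ^ length ys *s F ((xs @ [y]) @ ys @ x # zs) \<in> S"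
    using Cons.prems by (intro Cons.IH) simp
  ultimately show ?case using congruent_trans by fastforce
qed

text \<open>Sort the arrangements by their first letter \<open>s ! i\<close>. By induction the
  remaining letters contribute the factorial for one letter less, and moving \<open>s ! i\<close>
  back past the \<open>i\<close> smaller letters contributes \<open>u ^ i\<close>. Summing over
  \<open>i\<close> gives the missing factor \<open>qint u (length s)\<close>. The prefix
  \<open>xs\<close> absorbs the first letter in the induction.\<close>

lemma sum_permutations:
  assumes "sorted_wrt (<) s"
  shows "(\<Sum>w\<in>permutations_of_set (set s). F (xs @ w)) - qfact u (length s) *s F (xs @ s) \<in> S"
  using assms
proof (induction "length s" arbitrary: s xs)
  case 0
  then show ?case using S by (simp add: subspace_0 qfact_def)
next
  case (Suc n)
  \<comment> \<open>The list \<open>s\<close> without its entry at index \<open>i\<close>.\<close>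
  define s' where "s' i = take i s @ drop (Suc i) s" for i
  have dist: "distinct s" using Suc.prems strict_sorted_iff by blast
  have ne: "set s \<noteq> {}" using Suc.hyps(2) by auto
  have set_s': "set (s' i) = set s - {s ! i}" if "i < length s" for i
  proof -
    have "distinct (take i s @ s ! i # drop (Suc i) s)" "set s = set (take i s @ s ! i # drop (Suc i) s)"
      using id_take_nth_drop[OF that] dist by metis+
    then show ?thesis by (auto simp: s'_def)
  qed
  have step: "(\<Sum>w\<in>permutations_of_set (set s - {s ! i}). F (xs @ s ! i # w)) -
      (qfact u n * u ^ i) *s F (xs @ s) \<in> S" if i: "i < length s" for i
  proof (rule congruent_trans)
    have s: "sorted_wrt (<) (take i s @ s ! i # drop (Suc i) s)"
      using id_take_nth_drop[OF i] Suc.prems by metis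
    then have "sorted_wrt (<) (s' i)" by (auto simp: s'_def sorted_wrt_append)
    moreover have "n = length (s' i)" using Suc.hyps(2) i by (simp add: s'_def)
    ultimately have "(\<Sum>w\<in>permutations_of_set (set (s' i)). F ((xs @ [s ! i]) @ w)) -
        qfact u (length (s' i)) *s F ((xs @ [s ! i]) @ s' i) \<in> S"
      by (intro Suc.hyps(1))
    then show "(\<Sum>w\<in>permutations_of_set (set s - {s ! i}). F (xs @ s ! i # w)) -
        qfact u n *s F (xs @ s ! i # s' i) \<in> S"
      using \<open>n = length (s' i)\<close> by (simp add: set_s'[OF i])
    have "F (xs @ s ! i # take i s @ drop (Suc i) s) -
        u ^ length (take i s) *s F (xs @ take i s @ s ! i # drop (Suc i) s) \<in> S"
      using s by (intro move_right) (auto simp: sorted_wrt_append)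
    then show "F (xs @ s ! i # s' i) - u ^ i *s F (xs @ s) \<in> S"
      using i id_take_nth_drop[OF i] by (simp add: s'_def)
  qed
  have "(\<Sum>w\<in>permutations_of_set (set s). F (xs @ w)) =
      (\<Sum>x\<in>set s. \<Sum>w\<in>permutations_of_set (set s - {x}). F (xs @ x # w))"
    unfolding permutations_of_set_nonempty[OF ne]
    by (subst sum.UNION_disjoint) (auto simp: sum.reindex)
  also have "\<dots> = (\<Sum>i<length s. \<Sum>w\<in>permutations_of_set (set s - {s ! i}). F (xs @ s ! i # w))"
    by (rule sum.reindex_bij_betw[OF bij_betw_nth[OF dist], symmetric]) simp_all
  moreover have "qfact u (length s) = (\<Sum>i<length s. qfact u n * u ^ i)"
    by (simp add: qfact_def qint_def Suc.hyps(2)[symmetric] sum_distrib_right mult.commute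
        del: sum.lessThan_Suc)
  ultimately have "(\<Sum>w\<in>permutations_of_set (set s). F (xs @ w)) -
        qfact u (length s) *s F (xs @ s) =
      (\<Sum>i<length s. (\<Sum>w\<in>permutations_of_set (set s - {s ! i}). F (xs @ s ! i # w)) -
        (qfact u n * u ^ i) *s F (xs @ s))"
    by (simp add: sum_subtractf scale_sum_left)
  also have "\<dots> \<in> S" by (intro subspace_sum[OF S] step) simp
  finally show ?case .
qed

text \<open>Words with a repeated letter lie in \<open>S\<close>. By counting, a word without
  repetition that is as long as \<open>s\<close> uses every letter of \<open>s\<close>, so
  \<open>sum_permutations\<close> covers the rest.\<close>

lemma sum_words:
  assumes "sorted_wrt (<) s"
  shows "(\<Sum>w | set w \<subseteq> set s \<and> length w = length s. F w) - qfact u (length s) *s F s \<in> S"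
proof -
  let ?W = "{w. set w \<subseteq> set s \<and> length w = length s}"
  have card: "card (set s) = length s" using assms strict_sorted_iff distinct_card by blast
  have P: "permutations_of_set (set s) = {w \<in> ?W. distinct w}"
  proof (intro equalityI subsetI)
    fix w assume "w \<in> permutations_of_set (set s)"
    then show "w \<in> {w \<in> ?W. distinct w}"
      using card distinct_card[of w] by (simp add: permutations_of_set_def)
  next
    fix w assume w: "w \<in> {w \<in> ?W. distinct w}"
    then have "card (set w) = card (set s)"
      using card distinct_card[of w] by simp
    then show "w \<in> permutations_of_set (set s)"
      using w card_subset_eq[of "set s" "set w"] by (simp add: permutations_of_set_def)
  qed
  have fin: "finite ?W" by (simp add: finite_lists_length_eq)
  have "sum F ?W = sum F {w \<in> ?W. distinct w} + sum F {w \<in> ?W. \<not> distinct w}"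
    using fin by (subst sum.union_disjoint[symmetric]) (auto intro: sum.cong finite_subset[OF _ fin])
  then have "sum F ?W - qfact u (length s) *s F s =
      ((\<Sum>w\<in>permutations_of_set (set s). F ([] @ w)) - qfact u (length s) *s F ([] @ s)) +
      sum F {w \<in> ?W. \<not> distinct w}"
    by (simp add: P)
  also have "\<dots> \<in> S"
    by (intro subspace_add[OF S] sum_permutations assms subspace_sum[OF S] not_distinct) simp
  finally show ?thesis .
qed

end

section \<open>Column permanents in the free algebra\<close>

abbreviation scal :: "complex \<Rightarrow> falg" where
  "scal c \<equiv> Poly_Mapping.single 0 c"

text \<open>The empty word is neutral on both sides and complex coefficients commute, so the claim
  holds for monomials and extends by building \<open>f\<close> up one coefficient at a time.\<close>

lemma scal_commute: "f * scal c = scal c * f"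
proof (induction f rule: Poly_Mapping.update_induct)
  case const
  show ?case by simp
next
  case (update f a b)
  have "Poly_Mapping.update a b f = Poly_Mapping.single a b + f"
    using update.hyps(1)
    by (intro poly_mapping_eqI)
      (auto simp: lookup_update lookup_add lookup_single in_keys_iff when_def)
  then show ?case
    by (simp add: update.IH distrib_left distrib_right mult_single mult.commute)
qed

lemma scal_left_commute: "f * (scal c * g) = scal c * (f * g)"
  by (metis mult.assoc scal_commute)

text \<open>Brings an extra factor \<open>q\<close> next to the two exchanged letters, so that the
  common outer factors can be pulled out.\<close>

lemma scal_middle_commute: "scal d * (scal c * (f * (g * h))) = scal c * (f * (scal d * g * h))"
  by (metis mult.assoc scal_left_commute)

lemma scal_mult: "scal (c * d) = scal c * scal d"
  by (simp add: mult_single)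

lemma scal_uminus: "scal (- c) = - scal c"
  by (rule single_uminus)

interpretation falg: vector_space "\<lambda>c (f :: falg). scal c * f"
  by unfold_locales (simp_all add: distrib_left distrib_right single_add scal_mult mult.assoc)

text \<open>The swapped partner of each \<open>\<sigma>\<close> has one more inversion, hence the
  extra \<open>q\<close>. \<open>L\<close> and \<open>R\<close> stand for the factors at the other
  positions, which the swap does not touch.\<close>

lemma sum_inversions_adjacent_split:
  assumes k: "1 \<le> k" "k < N"
    and inv: "\<And>\<sigma>. Q (\<sigma> \<circ> transpose k (Suc k)) \<longleftrightarrow> Q \<sigma>"
      "\<And>\<sigma>. L (\<sigma> \<circ> transpose k (Suc k)) = L \<sigma>" "\<And>\<sigma>. R (\<sigma> \<circ> transpose k (Suc k)) = R \<sigma>"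
  shows "(\<Sum>\<sigma> | \<sigma> permutes {1..N} \<and> Q \<sigma>.
      scal (q ^ inv_number N \<sigma>) * (L \<sigma> * (g (\<sigma> k) (\<sigma> (Suc k)) * R \<sigma>))) =
    (\<Sum>\<sigma> | \<sigma> permutes {1..N} \<and> Q \<sigma> \<and> \<sigma> k < \<sigma> (Suc k).
      scal (q ^ inv_number N \<sigma>) *
        (L \<sigma> * ((g (\<sigma> k) (\<sigma> (Suc k)) + scal q * g (\<sigma> (Suc k)) (\<sigma> k)) * R \<sigma>)))"
  unfolding sum_permutes_adjacent_split[where Q = Q, OF k inv(1)]
proof (rule sum.cong[OF refl])
  fix \<sigma> assume "\<sigma> \<in> {\<sigma>. \<sigma> permutes {1..N} \<and> Q \<sigma> \<and> \<sigma> k < \<sigma> (Suc k)}"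
  then have "inv_number N (\<sigma> \<circ> transpose k (Suc k)) = Suc (inv_number N \<sigma>)"
    using inv_number_adjacent_swap k by blast
  then have e: "scal (q ^ inv_number N (\<sigma> \<circ> transpose k (Suc k))) = scal q * scal (q ^ inv_number N \<sigma>)"
    by (simp add: scal_mult[symmetric])
  show "scal (q ^ inv_number N \<sigma>) * (L \<sigma> * (g (\<sigma> k) (\<sigma> (Suc k)) * R \<sigma>)) +
      scal (q ^ inv_number N (\<sigma> \<circ> transpose k (Suc k))) *
        (L (\<sigma> \<circ> transpose k (Suc k)) * (g ((\<sigma> \<circ> transpose k (Suc k)) k)
          ((\<sigma> \<circ> transpose k (Suc k)) (Suc k)) * R (\<sigma> \<circ> transpose k (Suc k)))) =
      scal (q ^ inv_number N \<sigma>) *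
        (L \<sigma> * ((g (\<sigma> k) (\<sigma> (Suc k)) + scal q * g (\<sigma> (Suc k)) (\<sigma> k)) * R \<sigma>))"
    unfolding e inv(2,3) mult.assoc[of "scal q"] scal_middle_commute
    by (simp add: distrib_left distrib_right mult.assoc)
qed

definition col_per :: "complex \<Rightarrow> nat list \<Rightarrow> falg" where
  "col_per q w = (\<Sum>\<sigma> | \<sigma> permutes {1..length w}.
     scal (q ^ inv_number (length w) \<sigma>) * prod_list (map2 letter (map \<sigma> [1..<length w + 1]) w))"

text \<open>The cut-off makes the exchange rules below hold for all words, since zero satisfies them.\<close>

definition col_per_on :: "complex \<Rightarrow> nat \<Rightarrow> nat list \<Rightarrow> falg" where
  "col_per_on q N w = (if set w \<subseteq> {1..N} \<and> length w = N then col_per q w else 0)"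

text \<open>A representative of the quantum permanent of the 2 by 2 submatrix with rows
  \<open>i\<close>, \<open>j\<close> and columns \<open>k\<close>, \<open>l\<close>. The columns
  come first because they stay fixed while the rows vary with \<open>\<sigma>\<close>.\<close>

definition row_pair :: "complex \<Rightarrow> nat \<Rightarrow> nat \<Rightarrow> nat \<Rightarrow> nat \<Rightarrow> falg" where
  "row_pair q k l i j = letter i k * letter j l + scal q * (letter j k * letter i l)"

lemma col_per_adjacent_split:
  fixes xs ys :: "nat list"
  defines "t \<equiv> Suc (length xs)" and "N \<equiv> length xs + length ys + 2"
  defines "L \<equiv> \<lambda>\<sigma>. prod_list (map2 letter (map \<sigma> [1..<t]) xs)"
    and "R \<equiv> \<lambda>\<sigma>. prod_list (map2 letter (map \<sigma> [t + 2..<N + 1]) ys)"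
  shows "col_per q (xs @ k # l # ys) =
    (\<Sum>\<sigma> | \<sigma> permutes {1..N} \<and> \<sigma> t < \<sigma> (Suc t).
      scal (q ^ inv_number N \<sigma>) * (L \<sigma> * (row_pair q k l (\<sigma> t) (\<sigma> (Suc t)) * R \<sigma>)))"
proof -
  \<comment> \<open>Positions count from 1, so the columns \<open>k\<close> and \<open>l\<close>
    stand at positions \<open>t\<close> and \<open>t + 1\<close>.\<close>
  have up: "[1..<N + 1] = [1..<t] @ t # Suc t # [t + 2..<N + 1]"
  proof -
    have "[1..<N + 1] = [1..<t] @ [t..<N + 1]"
      by (metis N_def t_def upt_add_eq_append le_add1 plus_1_eq_Suc Suc_eq_plus1 add.assoc add_Suc)
    also have "[t..<N + 1] = t # Suc t # [t + 2..<N + 1]"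
      by (simp add: t_def N_def upt_conv_Cons del: upt_Suc)
    finally show ?thesis .
  qed
  have prod: "prod_list (map2 letter (map \<sigma> [1..<N + 1]) (xs @ k # l # ys)) =
      L \<sigma> * ((letter (\<sigma> t) k * letter (\<sigma> (Suc t)) l) * R \<sigma>)" for \<sigma>
    unfolding up L_def R_def by (simp add: t_def zip_append mult.assoc del: upt_Suc)
  have LR: "L (\<sigma> \<circ> transpose t (Suc t)) = L \<sigma>" "R (\<sigma> \<circ> transpose t (Suc t)) = R \<sigma>" for \<sigma>
  proof -
    have "map (\<sigma> \<circ> transpose t (Suc t)) [1..<t] = map \<sigma> [1..<t]"
      "map (\<sigma> \<circ> transpose t (Suc t)) [t + 2..<N + 1] = map \<sigma> [t + 2..<N + 1]"
      by (auto simp: transpose_def)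
    then show "L (\<sigma> \<circ> transpose t (Suc t)) = L \<sigma>" "R (\<sigma> \<circ> transpose t (Suc t)) = R \<sigma>"
      unfolding L_def R_def by metis+
  qed
  have N: "length (xs @ k # l # ys) = N" by (simp add: N_def)
  have "1 \<le> t" "t < N" by (simp_all add: t_def N_def)
  from sum_inversions_adjacent_split[where Q = "\<lambda>_. True" and L = L and R = R
      and g = "\<lambda>i j. letter i k * letter j l", OF this _ LR]
  show ?thesis
    unfolding col_per_def row_pair_def N prod by (simp only: simp_thms refl)
qed


section \<open>Column exchange modulo the defining relations\<close>

lemma qideal_subspace: "falg.subspace (qideal r s N)"
proof -
  interpret I: ideal "qideal r s N" "free_algebra N" by (rule ideal_qideal)
  show ?thesis
    by (rule falg.subspaceI)
      (use I.I_l_closed[OF _ scalar_in_free_algebra]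
        additive_subgroup.zero_closed[OF ideal.axioms(1)[OF ideal_qideal]]
        additive_subgroup.a_closed[OF ideal.axioms(1)[OF ideal_qideal]] in simp_all)
qed

lemma qideal_mult:
  assumes "x \<in> qideal r s N" "f \<in> carrier (free_algebra N)" "g \<in> carrier (free_algebra N)"
  shows "f * (x * g) \<in> qideal r s N"
proof -
  interpret I: ideal "qideal r s N" "free_algebra N" by (rule ideal_qideal)
  show ?thesis using I.I_l_closed[OF I.I_r_closed[OF assms(1,3)] assms(2)] by simp
qed

lemma qrelations_in_qideal: "qrelations r s N \<subseteq> qideal r s N"
  unfolding qideal_def by (rule ring.genideal_self[OF ring_free_algebra qrelations_subset])

lemma prod_list_in_free_algebra:
  "\<forall>x\<in>set xs. x \<in> carrier (free_algebra N) \<Longrightarrow> prod_list xs \<in> carrier (free_algebra N)"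
  by (induction xs)
    (simp_all add: free_algebra_closed scalar_in_free_algebra[of 1, simplified])

lemma sum_in_free_algebra:
  "\<forall>x\<in>A. f x \<in> carrier (free_algebra N) \<Longrightarrow> sum f A \<in> carrier (free_algebra N)"
  by (induction A rule: infinite_finite_induct)
    (simp_all add: free_algebra_closed scalar_in_free_algebra[of 0, simplified])

lemma map2_letter_in_free_algebra:
  assumes "set is \<subseteq> {1..N}" "set ks \<subseteq> {1..N}"
  shows "prod_list (map2 letter is ks) \<in> carrier (free_algebra N)"
  using assms
  by (intro prod_list_in_free_algebra)
    (auto elim!: in_set_zipE intro!: letter_in_free_algebra simp del: atLeastAtMost_iff)

context
  fixes q :: complex and N :: nat and I :: "falg set"
  defines "I \<equiv> qideal q (- inverse q) N"
  assumes q_nonzero: "q \<noteq> 0"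
begin

text \<open>Since \<open>s\<close> is \<open>- inverse q\<close>, its inverse is \<open>- q\<close>;
  this turns the minus sign of the defining relation into a plus, here and in the next
  lemma.\<close>

lemma relation_column:
  assumes "i \<in> {1..N}" "j \<in> {1..N}" "k \<in> {1..N}" "i < j"
  shows "letter i k * letter j k + scal q * (letter j k * letter i k) \<in> I"
proof -
  have "letter i k * letter j k - scal (inverse (- inverse q)) * (letter j k * letter i k) \<in> I"
    unfolding I_def using assms
    by (intro subsetD[OF qrelations_in_qideal]) (unfold qrelations_def Let_def, blast)
  then show ?thesis by (simp add: scal_uminus)
qed

lemma relation_antidiagonal:
  assumes "i \<in> {1..N}" "j \<in> {1..N}" "k \<in> {1..N}" "l \<in> {1..N}" "i < j" "k < l"
  shows "scal q * (letter i l * letter j k + letter j k * letter i l) \<in> I"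
proof -
  have "scal q * (letter i l * letter j k) -
      scal (inverse (- inverse q)) * (letter j k * letter i l) \<in> I"
    unfolding I_def using assms
    by (intro subsetD[OF qrelations_in_qideal]) (unfold qrelations_def Let_def, blast)
  then show ?thesis by (simp add: scal_uminus distrib_left)
qed

lemma relation_diagonal:
  assumes "i \<in> {1..N}" "j \<in> {1..N}" "k \<in> {1..N}" "l \<in> {1..N}" "i < j" "k < l"
  shows "letter i k * letter j l - letter j l * letter i k -
    scal (q + inverse q) * (letter i l * letter j k) \<in> I"
proof -
  have "letter i k * letter j l - letter j l * letter i k -
    scal (q - (- inverse q)) * (letter i l * letter j k) \<in> I"
    unfolding I_def using assms
    by (intro subsetD[OF qrelations_in_qideal]) (unfold qrelations_def Let_def, blast)
  then show ?thesis by simp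
qed

text \<open>The difference is exactly \<open>- q\<close> times the sum of the diagonal and the
  antidiagonal relation. The coefficient \<open>q * q + 1\<close> from the former loses its
  \<open>q * q\<close> to the latter.\<close>

lemma row_pair_swap:
  assumes "i \<in> {1..N}" "j \<in> {1..N}" "k \<in> {1..N}" "l \<in> {1..N}" "i < j" "k < l"
  shows "row_pair q l k i j - scal q * row_pair q k l i j \<in> I"
proof -
  let ?a = letter
  have c: "scal q * scal (q + inverse q) = scal q * scal q + 1"
    using q_nonzero by (simp add: mult_single distrib_left single_add)
  have "scal (- q) * ((?a i k * ?a j l - ?a j l * ?a i k - scal (q + inverse q) * (?a i l * ?a j k))
      + scal q * (?a i l * ?a j k + ?a j k * ?a i l)) =
    - (scal q * (?a i k * ?a j l)) + scal q * (?a j l * ?a i k)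
      + (scal q * scal (q + inverse q)) * (?a i l * ?a j k)
      - scal q * (scal q * (?a i l * ?a j k)) - scal q * (scal q * (?a j k * ?a i l))"
    by (simp add: scal_uminus algebra_simps)
  also have "\<dots> = row_pair q l k i j - scal q * row_pair q k l i j"
    unfolding c row_pair_def by (simp add: algebra_simps)
  finally show ?thesis
    using falg.subspace_scale[OF qideal_subspace falg.subspace_add[OF qideal_subspace
        relation_diagonal[OF assms, unfolded I_def] relation_antidiagonal[OF assms, unfolded I_def]], of "- q"]
    by (simp add: I_def)
qed

lemma row_pair_rep:
  assumes "i \<in> {1..N}" "j \<in> {1..N}" "k \<in> {1..N}" "i < j"
  shows "row_pair q k k i j \<in> I"
  using relation_column[OF assms] by (simp add: row_pair_def)

text \<open>The restriction on \<open>\<sigma>\<close> puts the two rows in increasing order, so the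
  middle factor of each summand lies in the two-sided ideal. Leaving \<open>d\<close> open serves
  both the exchange of columns and the case of equal columns.\<close>

lemma sum_row_pairs_in_qideal:
  fixes xs ys :: "nat list"
  assumes "set xs \<subseteq> {1..N}" "set ys \<subseteq> {1..N}" and N: "N = length xs + length ys + 2"
    and d: "\<And>i j. i \<in> {1..N} \<Longrightarrow> j \<in> {1..N} \<Longrightarrow> i < j \<Longrightarrow> d i j \<in> I"
  defines "t \<equiv> Suc (length xs)"
  shows "(\<Sum>\<sigma> | \<sigma> permutes {1..N} \<and> \<sigma> t < \<sigma> (Suc t).
      scal (q ^ inv_number N \<sigma>) * (prod_list (map2 letter (map \<sigma> [1..<t]) xs) *
        (d (\<sigma> t) (\<sigma> (Suc t)) * prod_list (map2 letter (map \<sigma> [t + 2..<N + 1]) ys)))) \<in> I"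
  unfolding I_def
proof (intro falg.subspace_sum[OF qideal_subspace] falg.subspace_scale[OF qideal_subspace] qideal_mult)
  fix \<sigma> assume "\<sigma> \<in> {\<sigma>. \<sigma> permutes {1..N} \<and> \<sigma> t < \<sigma> (Suc t)}"
  then have \<sigma>: "\<sigma> permutes {1..N}" "\<sigma> t < \<sigma> (Suc t)" by simp_all
  have in_N: "\<sigma> i \<in> {1..N}" if "1 \<le> i" "i \<le> N" for i
    using permutes_in_image[OF \<sigma>(1), of i] that by simp
  show "d (\<sigma> t) (\<sigma> (Suc t)) \<in> qideal q (- inverse q) N"
    using d[OF in_N in_N \<sigma>(2)] by (simp add: I_def t_def N)
  show "prod_list (map2 letter (map \<sigma> [1..<t]) xs) \<in> carrier (free_algebra N)"
    using assms(1) in_N by (intro map2_letter_in_free_algebra) (auto simp: t_def N)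
  show "prod_list (map2 letter (map \<sigma> [t + 2..<N + 1]) ys) \<in> carrier (free_algebra N)"
    using assms(2) in_N by (intro map2_letter_in_free_algebra) (auto simp: t_def)
qed

lemma col_per_swap:
  assumes w: "set (xs @ k # l # ys) \<subseteq> {1..N}" "length (xs @ k # l # ys) = N" and "k < l"
  shows "col_per q (xs @ l # k # ys) - scal q * col_per q (xs @ k # l # ys) \<in> I"
proof -
  have N: "N = length xs + length ys + 2" using w(2) by simp
  have "scal p * (f * (row_pair q l k i j * g)) - scal q * (scal p * (f * (row_pair q k l i j * g))) =
      scal p * (f * ((row_pair q l k i j - scal q * row_pair q k l i j) * g))" for p f g i j
    unfolding scal_middle_commute by (simp only: left_diff_distrib right_diff_distrib)
  then show ?thesis
    using sum_row_pairs_in_qideal[where xs = xs and ys = ys and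
        d = "\<lambda>i j. row_pair q l k i j - scal q * row_pair q k l i j"] w N row_pair_swap \<open>k < l\<close>
    unfolding col_per_adjacent_split N[symmetric] sum_distrib_left sum_subtractf[symmetric]
    by simp
qed

lemma col_per_rep:
  assumes w: "set (xs @ k # k # ys) \<subseteq> {1..N}" "length (xs @ k # k # ys) = N"
  shows "col_per q (xs @ k # k # ys) \<in> I"
proof -
  have N: "N = length xs + length ys + 2" using w(2) by simp
  show ?thesis
    using sum_row_pairs_in_qideal[where xs = xs and ys = ys and d = "row_pair q k k"]
      w N row_pair_rep
    unfolding col_per_adjacent_split N[symmetric] by simp
qed

lemma q_symmetric_col_per: "q_symmetric (\<lambda>c f. scal c * f) I q (col_per_on q N)"
proof unfold_locales
  show "falg.subspace I" unfolding I_def by (rule qideal_subspace)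
  then have "0 \<in> I" by (rule falg.subspace_0)
  then show "col_per_on q N (xs @ l # k # ys) - scal q * col_per_on q N (xs @ k # l # ys) \<in> I"
    if "k < l" for k l xs ys
    using that col_per_swap[of xs k l ys] by (auto simp: col_per_on_def)
  show "col_per_on q N (xs @ k # k # ys) \<in> I" for k xs ys
    using \<open>0 \<in> I\<close> col_per_rep[of xs k ys] by (auto simp: col_per_on_def)
qed (fact q_nonzero)

end

section \<open>Pairs of columns\<close>

text \<open>The letter \<open>m\<close> stands for the two columns met by the \<open>m\<close>-th
  diagonal block of \<open>JJ\<close>.\<close>

definition pair_word :: "nat list \<Rightarrow> nat list" where
  "pair_word w = concat (map (\<lambda>m. [2 * m - 1, 2 * m]) w)"

lemma pair_word_simps [simp]:
  "pair_word [] = []" "pair_word (m # w) = (2 * m - 1) # 2 * m # pair_word w"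
  "pair_word (v @ w) = pair_word v @ pair_word w"
  by (simp_all add: pair_word_def)

lemma length_pair_word [simp]: "length (pair_word w) = 2 * length w"
  by (induction w) simp_all

lemma set_pair_word: "set w \<subseteq> {1..n} \<Longrightarrow> set (pair_word w) \<subseteq> {1..2 * n}"
  by (induction w) auto

lemma pair_word_upt: "pair_word [1..<n + 1] = [1..<2 * n + 1]"
  by (induction n) simp_all

text \<open>Appending a letter on the right leaves the earlier positions unchanged, hence the
  reversed induction.\<close>

lemma prod_list_pair_word:
  "prod_list (map2 letter (map \<sigma> [1..<2 * length w + 1]) (pair_word w)) =
    prod_list (map2 (\<lambda>i m. letter (\<sigma> (2 * i - 1)) (2 * m - 1) * letter (\<sigma> (2 * i)) (2 * m))
      [1..<length w + 1] w)"
proof (induction w rule: rev_induct)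
  case (snoc m w)
  have "[1..<2 * length (w @ [m]) + 1] =
      [1..<2 * length w + 1] @ [2 * length w + 1, 2 * length w + 2]"
    "[1..<length (w @ [m]) + 1] = [1..<length w + 1] @ [length w + 1]"
    by simp_all
  then show ?case using snoc.IH by (simp add: zip_append mult.assoc del: upt_Suc)
qed simp

text \<open>Both columns of the smaller pair lie below both columns of the larger one, so exchanging
  the pairs takes four adjacent exchanges, each costing \<open>u\<close>. A repeated pair repeats a
  column.\<close>

lemma q_symmetric_pairs:
  assumes "q_symmetric scale S u F"
  shows "q_symmetric scale S (u ^ 4) (\<lambda>w. F (pair_word w))"
proof -
  interpret q_symmetric scale S u F by fact
  show ?thesis
  proof unfold_locales
    show "subspace S" by (rule S)
    show "u ^ 4 \<noteq> 0" using u_nonzero by simp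
    show "F (pair_word (xs @ k # k # ys)) \<in> S" for k xs ys
      by (rule not_distinct) simp
    show "F (pair_word (xs @ l # k # ys)) - scale (u ^ 4) (F (pair_word (xs @ k # l # ys))) \<in> S"
      if "k < l" for k l xs ys
    proof (cases "k = 0")
      case True \<comment> \<open>truncated subtraction: the letter \<open>0\<close> yields the pair \<open>0, 0\<close>\<close>
      then have "F (pair_word (xs @ l # k # ys)) \<in> S" "F (pair_word (xs @ k # l # ys)) \<in> S"
        by (auto intro!: not_distinct)
      then show ?thesis by (intro subspace_diff[OF S] subspace_scale[OF S])
    next
      case False
      let ?a = "2 * k - 1" and ?b = "2 * k" and ?c = "2 * l - 1" and ?d = "2 * l"
      let ?x = "pair_word xs" and ?y = "pair_word ys"
      have "?a < ?d" "?a < ?c" "?b < ?d" "?b < ?c"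
        using \<open>k < l\<close> False by auto
      \<comment> \<open>First \<open>?a\<close> moves left past \<open>?d\<close> and
        \<open>?c\<close>, then \<open>?b\<close> does the same.\<close>
      have "F (?x @ ?c # ?d # ?a # ?b # ?y) - scale u (F (?x @ ?c # ?a # ?d # ?b # ?y)) \<in> S"
        using swap[OF \<open>?a < ?d\<close>, of "?x @ [?c]" "?b # ?y"] by simp
      moreover have "F (?x @ ?c # ?a # ?d # ?b # ?y) - scale u (F (?x @ ?a # ?c # ?d # ?b # ?y)) \<in> S"
        using swap[OF \<open>?a < ?c\<close>, of "?x" "?d # ?b # ?y"] by simp
      moreover have "F (?x @ ?a # ?c # ?d # ?b # ?y) - scale u (F (?x @ ?a # ?c # ?b # ?d # ?y)) \<in> S"
        using swap[OF \<open>?b < ?d\<close>, of "?x @ [?a, ?c]" "?y"] by simp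
      moreover have "F (?x @ ?a # ?c # ?b # ?d # ?y) - scale u (F (?x @ ?a # ?b # ?c # ?d # ?y)) \<in> S"
        using swap[OF \<open>?b < ?c\<close>, of "?x @ [?a]" "?d # ?y"] by simp
      ultimately have "F (?x @ ?c # ?d # ?a # ?b # ?y) -
          scale (u * (u * (u * u))) (F (?x @ ?a # ?b # ?c # ?d # ?y)) \<in> S"
        by (intro congruent_trans)
      then show ?thesis by (simp add: power4_eq_xxxx mult.assoc)
    qed
  qed
qed

text \<open>This is \<open>sum_words\<close> for pairs of columns. All the words summed have letters
  and length within the cut-off of \<open>col_per_on\<close>, which therefore disappears.\<close>

lemma sum_col_per_pair_words:
  assumes "q \<noteq> 0"
  shows "(\<Sum>w | set w \<subseteq> {1..n} \<and> length w = n. col_per q (pair_word w)) -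
    scal (qfact (q ^ 4) n) * col_per q [1..<2 * n + 1] \<in> qideal q (- inverse q) (2 * n)"
proof -
  interpret q_symmetric "\<lambda>c f. scal c * f" "qideal q (- inverse q) (2 * n)" "q ^ 4"
    "\<lambda>w. col_per_on q (2 * n) (pair_word w)"
    by (rule q_symmetric_pairs[OF q_symmetric_col_per[OF assms]])
  have on: "col_per_on q (2 * n) (pair_word w) = col_per q (pair_word w)"
    if "set w \<subseteq> {1..n}" "length w = n" for w
    using set_pair_word[OF that(1)] that(2) by (simp add: col_per_on_def)
  have set_upt: "set [1..<n + 1] = {1..n}" by auto
  have "(\<Sum>w | set w \<subseteq> {1..n} \<and> length w = n. col_per_on q (2 * n) (pair_word w)) -
      scal (qfact (q ^ 4) n) * col_per_on q (2 * n) (pair_word [1..<n + 1]) \<in>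
      qideal q (- inverse q) (2 * n)"
    using sum_words[of "[1..<n + 1]"] unfolding set_upt by (simp del: upt_Suc)
  moreover have "col_per_on q (2 * n) (pair_word [1..<n + 1]) = col_per q (pair_word [1..<n + 1])"
    by (rule on) (auto simp del: upt_Suc)
  ultimately show ?thesis unfolding pair_word_upt by (simp add: on)
qed

lemma hafnian_sum_unfold:
  fixes h :: "nat \<Rightarrow> nat \<Rightarrow> falg"
  shows "(\<Sum>\<sigma> | \<sigma> permutes {1..2 * n} \<and> (\<forall>i\<in>{1..n}. \<sigma> (2 * i - 1) < \<sigma> (2 * i)).
      scal (q ^ inv_number (2 * n) \<sigma>) * prod_list (map (\<lambda>i. h (\<sigma> (2 * i - 1)) (\<sigma> (2 * i)) +
        scal q * h (\<sigma> (2 * i)) (\<sigma> (2 * i - 1))) [1..<n + 1])) =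
    (\<Sum>\<sigma> | \<sigma> permutes {1..2 * n}.
      scal (q ^ inv_number (2 * n) \<sigma>) *
        prod_list (map (\<lambda>i. h (\<sigma> (2 * i - 1)) (\<sigma> (2 * i))) [1..<n + 1]))"
proof -
  \<comment> \<open>The constraint on the first \<open>t\<close> pairs is traded for the plain factor \<open>h\<close>, one pair at a time.\<close>
  define b where "b i j = h i j + scal q * h j i" for i j
  let ?Q = "\<lambda>t \<sigma>. \<forall>i\<in>{1..t}. \<sigma> (2 * i - 1) < (\<sigma> (2 * i) :: nat)"
  let ?L = "\<lambda>t \<sigma>. prod_list (map (\<lambda>i. b (\<sigma> (2 * i - 1)) (\<sigma> (2 * i))) [1..<t + 1])"
  let ?R = "\<lambda>t \<sigma>. prod_list (map (\<lambda>i. h (\<sigma> (2 * i - 1)) (\<sigma> (2 * i))) [t + 1..<n + 1])"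
  have "(\<Sum>\<sigma> | \<sigma> permutes {1..2 * n} \<and> ?Q t \<sigma>. scal (q ^ inv_number (2 * n) \<sigma>) * (?L t \<sigma> * ?R t \<sigma>)) =
    (\<Sum>\<sigma> | \<sigma> permutes {1..2 * n}. scal (q ^ inv_number (2 * n) \<sigma>) * ?R 0 \<sigma>)" if "t \<le> n" for t
    using that
  proof (induction t)
    case 0
    show ?case by simp
  next
    case (Suc t)
    \<comment> \<open>The first position of pair \<open>t + 1\<close>; transposing it with its
      successor moves no other pair.\<close>
    let ?k = "2 * t + 1"
    have k: "1 \<le> ?k" "?k < 2 * n" using Suc.prems by simp_all
    have fixed: "transpose ?k (Suc ?k) (2 * i - 1) = 2 * i - 1"
      "transpose ?k (Suc ?k) (2 * i) = 2 * i" if "1 \<le> i" "i \<noteq> t + 1" for i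
      using that by (auto simp: transpose_def)
    have Q: "?Q t (\<sigma> \<circ> transpose ?k (Suc ?k)) \<longleftrightarrow> ?Q t \<sigma>" for \<sigma>
    proof (intro ball_cong refl)
      fix i assume "i \<in> {1..t}"
      then have "1 \<le> i" "i \<noteq> t + 1" by auto
      from fixed[OF this] show "((\<sigma> \<circ> transpose ?k (Suc ?k)) (2 * i - 1) < (\<sigma> \<circ> transpose ?k (Suc ?k)) (2 * i)) =
          (\<sigma> (2 * i - 1) < \<sigma> (2 * i))"
        by (simp only: comp_apply)
    qed
    have "map (\<lambda>i. b ((\<sigma> \<circ> transpose ?k (Suc ?k)) (2 * i - 1)) ((\<sigma> \<circ> transpose ?k (Suc ?k)) (2 * i)))
        [1..<t + 1] = map (\<lambda>i. b (\<sigma> (2 * i - 1)) (\<sigma> (2 * i))) [1..<t + 1]" for \<sigma>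
      using fixed by (intro map_cong) auto
    then have L: "?L t (\<sigma> \<circ> transpose ?k (Suc ?k)) = ?L t \<sigma>" for \<sigma> by metis
    have "map (\<lambda>i. h ((\<sigma> \<circ> transpose ?k (Suc ?k)) (2 * i - 1)) ((\<sigma> \<circ> transpose ?k (Suc ?k)) (2 * i)))
        [Suc t + 1..<n + 1] = map (\<lambda>i. h (\<sigma> (2 * i - 1)) (\<sigma> (2 * i))) [Suc t + 1..<n + 1]" for \<sigma>
      using fixed by (intro map_cong) auto
    then have R: "?R (Suc t) (\<sigma> \<circ> transpose ?k (Suc ?k)) = ?R (Suc t) \<sigma>" for \<sigma> by metis
    have Rt: "?R t \<sigma> = h (\<sigma> ?k) (\<sigma> (Suc ?k)) * ?R (Suc t) \<sigma>" for \<sigma>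
      using Suc.prems by (simp add: upt_conv_Cons del: upt_Suc)
    have Lt: "?L (Suc t) \<sigma> * x = ?L t \<sigma> * (b (\<sigma> ?k) (\<sigma> (Suc ?k)) * x)" for \<sigma> x
      by (simp add: mult.assoc)
    have Qt: "?Q (Suc t) \<sigma> \<longleftrightarrow> ?Q t \<sigma> \<and> \<sigma> ?k < \<sigma> (Suc ?k)" for \<sigma>
      by (auto simp: atLeastAtMostSuc_conv)
    show ?case
      using sum_inversions_adjacent_split[where Q = "?Q t" and L = "?L t" and R = "?R (Suc t)"
          and g = h and q = q, OF k Q L R] Suc
      unfolding Rt Lt Qt b_def[symmetric] by (simp only: Suc_leD)
  qed
  from this[OF order_refl] show ?thesis by (simp add: b_def)
qed

text \<open>After \<open>hafnian_sum_unfold\<close>, expanding the product of the sums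
  \<open>h\<close> chooses a block \<open>m\<close> for each pair of rows. The choices form the word
  \<open>w\<close>, and the two summations are interchanged.\<close>

lemma sum_col_per_pair_words_eq_hafnian_sum:
  fixes n :: nat and q :: complex
  defines "h \<equiv> \<lambda>i j. \<Sum>m\<in>{1..n}. letter i (2 * m - 1) * letter j (2 * m)"
  shows "(\<Sum>w | set w \<subseteq> {1..n} \<and> length w = n. col_per q (pair_word w)) =
    (\<Sum>\<sigma> | \<sigma> permutes {1..2 * n} \<and> (\<forall>i\<in>{1..n}. \<sigma> (2 * i - 1) < \<sigma> (2 * i)).
      scal (q ^ inv_number (2 * n) \<sigma>) * prod_list (map (\<lambda>i. h (\<sigma> (2 * i - 1)) (\<sigma> (2 * i)) +
        scal q * h (\<sigma> (2 * i)) (\<sigma> (2 * i - 1))) [1..<n + 1]))"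
proof -
  let ?W = "{w. set w \<subseteq> {1..n} \<and> length w = n}"
  have "col_per q (pair_word w) =
      (\<Sum>\<sigma> | \<sigma> permutes {1..2 * n}. scal (q ^ inv_number (2 * n) \<sigma>) *
        prod_list (map2 (\<lambda>i m. letter (\<sigma> (2 * i - 1)) (2 * m - 1) *
          letter (\<sigma> (2 * i)) (2 * m)) [1..<n + 1] w))" if "length w = n" for w
    unfolding col_per_def length_pair_word prod_list_pair_word unfolding that ..
  then have "(\<Sum>w\<in>?W. col_per q (pair_word w)) =
      (\<Sum>\<sigma> | \<sigma> permutes {1..2 * n}. scal (q ^ inv_number (2 * n) \<sigma>) *
        (\<Sum>w\<in>?W. prod_list (map2 (\<lambda>i m. letter (\<sigma> (2 * i - 1)) (2 * m - 1) *
          letter (\<sigma> (2 * i)) (2 * m)) [1..<n + 1] w)))"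
    unfolding sum_distrib_left
    by (subst sum.swap) (simp del: upt_Suc)
  then show ?thesis
    unfolding hafnian_sum_unfold[where h = h] unfolding h_def
    by (simp add: prod_list_sum_distrib del: upt_Suc)
qed


section \<open>Passing to the quantum coordinate ring\<close>

context
  fixes q r s :: complex and N :: nat
begin

abbreviation (input) coset :: "falg \<Rightarrow> falg set" where
  "coset f \<equiv> qideal r s N +>\<^bsub>free_algebra N\<^esub> f"

interpretation M: ring "qcoord r s N" by (rule ring_qcoord)

lemma coset_hom:
  assumes "f \<in> carrier (free_algebra N)" "g \<in> carrier (free_algebra N)"
  shows "coset f \<oplus>\<^bsub>qcoord r s N\<^esub> coset g = coset (f + g)"
    "coset f \<otimes>\<^bsub>qcoord r s N\<^esub> coset g = coset (f * g)"
  using ring_hom_add[OF ideal.rcos_ring_hom[OF ideal_qideal] assms]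
    ring_hom_mult[OF ideal.rcos_ring_hom[OF ideal_qideal] assms]
  by (simp_all add: qcoord_simps)

lemma coset_one: "\<one>\<^bsub>qcoord r s N\<^esub> = coset 1"
  using ring_hom_one[OF ideal.rcos_ring_hom[OF ideal_qideal]] by (simp add: qcoord_simps)

lemma coset_zero: "\<zero>\<^bsub>qcoord r s N\<^esub> = coset 0"
  using ring_hom_zero[OF ideal.rcos_ring_hom[OF ideal_qideal] ring_free_algebra
      ideal.quotient_is_ring[OF ideal_qideal]]
  by (simp add: qcoord_simps)

lemma coset_smult:
  "f \<in> carrier (free_algebra N) \<Longrightarrow> c \<odot>\<^bsub>qcoord r s N\<^esub> coset f = coset (scal c * f)"
  using qcoord_smult_coset[where c = c] by simp

lemma coset_closed:
  "f \<in> carrier (free_algebra N) \<Longrightarrow> coset f \<in> carrier (qcoord r s N)"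
  using ring_hom_closed[OF ideal.rcos_ring_hom[OF ideal_qideal]] by (simp add: qcoord_simps)

lemma coset_eqI:
  assumes "f - g \<in> qideal r s N" "g \<in> carrier (free_algebra N)"
  shows "coset f = coset g"
proof -
  interpret I: ideal "qideal r s N" "free_algebra N" by (rule ideal_qideal)
  have "f \<in> coset g"
    using assms(1) by (force simp: a_r_coset_def r_coset_def)
  then show ?thesis using I.a_repr_independence' assms(2) by metis
qed

lemma coset_finsum:
  assumes "finite A" "\<And>x. x \<in> A \<Longrightarrow> f x \<in> carrier (free_algebra N)"
  shows "(\<Oplus>\<^bsub>qcoord r s N\<^esub>x\<in>A. coset (f x)) = coset (sum f A)"
  using assms
  by (induction A rule: finite_induct)
    (simp_all add: coset_zero coset_hom(1) coset_closed sum_in_free_algebra)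

lemma coset_ordered_prod:
  assumes "\<And>x. x \<in> set xs \<Longrightarrow> f x \<in> carrier (free_algebra N)"
  shows "ordered_prod (qcoord r s N) (map (\<lambda>x. coset (f x)) xs) = coset (prod_list (map f xs))"
  using assms
  by (induction xs)
    (simp_all add: ordered_prod_def coset_one coset_hom(2) prod_list_in_free_algebra)

text \<open>The size \<open>d\<close> is separate from \<open>N\<close> because both the full matrix
  and its 2 by 2 submatrices are needed.\<close>

lemma coset_qper:
  assumes "\<And>i j. i \<in> {1..d} \<Longrightarrow> j \<in> {1..d} \<Longrightarrow> Y i j \<in> carrier (free_algebra N)"
  shows "qper (qcoord r s N) q d (\<lambda>i j. coset (Y i j)) =
    coset (\<Sum>\<sigma> | \<sigma> permutes {1..d}.
      scal (q ^ inv_number d \<sigma>) * prod_list (map (\<lambda>k. Y (\<sigma> k) k) [1..<d + 1]))"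
proof -
  have Y: "Y (\<sigma> k) k \<in> carrier (free_algebra N)"
    if "\<sigma> permutes {1..d}" "k \<in> set [1..<d + 1]" for \<sigma> k
    using that permutes_in_image[OF that(1), of k] by (intro assms) auto
  have P: "prod_list (map (\<lambda>k. Y (\<sigma> k) k) [1..<d + 1]) \<in> carrier (free_algebra N)"
    if "\<sigma> permutes {1..d}" for \<sigma>
    using Y[OF that] by (intro prod_list_in_free_algebra) auto
  have summand: "q ^ inv_number d \<sigma> \<odot>\<^bsub>qcoord r s N\<^esub>
      ordered_prod (qcoord r s N) (map (\<lambda>k. coset (Y (\<sigma> k) k)) [1..<d + 1]) =
      coset (scal (q ^ inv_number d \<sigma>) * prod_list (map (\<lambda>k. Y (\<sigma> k) k) [1..<d + 1]))"
    if "\<sigma> permutes {1..d}" for \<sigma>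
    using coset_ordered_prod[of "[1..<d + 1]" "\<lambda>k. Y (\<sigma> k) k", OF Y[OF that]]
      coset_smult[OF P[OF that]]
    by (simp only:)
  have cl: "scal (q ^ inv_number d \<sigma>) * prod_list (map (\<lambda>k. Y (\<sigma> k) k) [1..<d + 1]) \<in>
      carrier (free_algebra N)" if "\<sigma> permutes {1..d}" for \<sigma>
    using P[OF that] by (intro free_algebra_closed scalar_in_free_algebra)
  show ?thesis
    unfolding qper_def
    by (subst coset_finsum[symmetric], simp add: finite_permutations, use cl in blast,
        rule M.finsum_cong') (use summand coset_closed cl in auto)
qed

text \<open>The constraint on \<open>\<sigma>\<close> makes the Hafnian read only entries above the
  diagonal, so representatives are required only for \<open>i < j\<close>.\<close>

lemma coset_qHf:
  assumes X: "\<And>i j. 1 \<le> i \<Longrightarrow> i < j \<Longrightarrow> j \<le> 2 * n \<Longrightarrow> X i j = coset (Y i j)"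
    and Y: "\<And>i j. 1 \<le> i \<Longrightarrow> i < j \<Longrightarrow> j \<le> 2 * n \<Longrightarrow> Y i j \<in> carrier (free_algebra N)"
  defines "H \<equiv> \<Sum>\<sigma> | \<sigma> permutes {1..2 * n} \<and> (\<forall>i\<in>{1..n}. \<sigma> (2 * i - 1) < \<sigma> (2 * i)).
      scal (q ^ inv_number (2 * n) \<sigma>) *
        prod_list (map (\<lambda>i. Y (\<sigma> (2 * i - 1)) (\<sigma> (2 * i))) [1..<n + 1])"
  shows "qHf (qcoord r s N) q n X = coset (scal (1 / qfact (q ^ 4) n) * H)"
    "H \<in> carrier (free_algebra N)"
proof -
  let ?S = "{\<sigma>. \<sigma> permutes {1..2 * n} \<and> (\<forall>i\<in>{1..n}. \<sigma> (2 * i - 1) < \<sigma> (2 * i))}"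
  let ?f = "\<lambda>\<sigma> i. Y (\<sigma> (2 * i - 1)) (\<sigma> (2 * i))"
  have fin: "finite ?S"
    by (rule finite_subset[OF _ finite_permutations[of "{1..2 * n}"]]) auto
  have range: "1 \<le> \<sigma> (2 * i - 1)" "\<sigma> (2 * i - 1) < \<sigma> (2 * i)" "\<sigma> (2 * i) \<le> 2 * n"
    if "\<sigma> \<in> ?S" "i \<in> set [1..<n + 1]" for \<sigma> i
  proof -
    have "\<sigma> permutes {1..2 * n}" "i \<in> {1..n}" "2 * i - 1 \<in> {1..2 * n}" "2 * i \<in> {1..2 * n}"
      using that by auto
    moreover from this(3,4) have "\<sigma> (2 * i - 1) \<in> {1..2 * n}" "\<sigma> (2 * i) \<in> {1..2 * n}"
      by (simp_all only: permutes_in_image[OF \<open>\<sigma> permutes {1..2 * n}\<close>])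
    ultimately show "1 \<le> \<sigma> (2 * i - 1)" "\<sigma> (2 * i - 1) < \<sigma> (2 * i)" "\<sigma> (2 * i) \<le> 2 * n"
      using that(1) by simp_all
  qed
  have f: "?f \<sigma> i \<in> carrier (free_algebra N)" if "\<sigma> \<in> ?S" "i \<in> set [1..<n + 1]" for \<sigma> i
    by (rule Y[OF range[OF that]])
  have P: "prod_list (map (?f \<sigma>) [1..<n + 1]) \<in> carrier (free_algebra N)" if "\<sigma> \<in> ?S" for \<sigma>
    using f[OF that] by (intro prod_list_in_free_algebra) auto
  then have cl: "scal (q ^ inv_number (2 * n) \<sigma>) * prod_list (map (?f \<sigma>) [1..<n + 1]) \<in>
      carrier (free_algebra N)" if "\<sigma> \<in> ?S" for \<sigma>
    using that by (intro free_algebra_closed scalar_in_free_algebra)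
  then show H: "H \<in> carrier (free_algebra N)"
    unfolding H_def by (intro sum_in_free_algebra) blast
  have summand: "q ^ inv_number (2 * n) \<sigma> \<odot>\<^bsub>qcoord r s N\<^esub> ordered_prod (qcoord r s N)
        (map (\<lambda>i. X (\<sigma> (2 * i - 1)) (\<sigma> (2 * i))) [1..<n + 1]) =
      coset (scal (q ^ inv_number (2 * n) \<sigma>) * prod_list (map (?f \<sigma>) [1..<n + 1]))"
    if \<sigma>: "\<sigma> \<in> ?S" for \<sigma>
  proof -
    have "map (\<lambda>i. X (\<sigma> (2 * i - 1)) (\<sigma> (2 * i))) [1..<n + 1] =
        map (\<lambda>i. coset (?f \<sigma> i)) [1..<n + 1]"
      by (rule map_cong[OF refl]) (rule X[OF range[OF \<sigma>]])
    then show ?thesis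
      using coset_ordered_prod[of "[1..<n + 1]" "?f \<sigma>", OF f[OF \<sigma>]] coset_smult[OF P[OF \<sigma>]]
      by (simp only:)
  qed
  have "(\<Oplus>\<^bsub>qcoord r s N\<^esub>\<sigma>\<in>?S. q ^ inv_number (2 * n) \<sigma> \<odot>\<^bsub>qcoord r s N\<^esub>
      ordered_prod (qcoord r s N) (map (\<lambda>i. X (\<sigma> (2 * i - 1)) (\<sigma> (2 * i))) [1..<n + 1])) =
      (\<Oplus>\<^bsub>qcoord r s N\<^esub>\<sigma>\<in>?S.
        coset (scal (q ^ inv_number (2 * n) \<sigma>) * prod_list (map (?f \<sigma>) [1..<n + 1])))"
    by (rule M.finsum_cong'[OF refl]) (use cl coset_closed summand in blast)+
  also have "\<dots> = coset H"
    unfolding H_def by (rule coset_finsum[OF fin cl])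
  finally show "qHf (qcoord r s N) q n X = coset (scal (1 / qfact (q ^ 4) n) * H)"
    unfolding qHf_def using coset_smult[OF H] by simp
qed

end

section \<open>Entries of the congruence product and comparison of Hafnian and permanent\<close>

lemma sum_pairs: "(\<Sum>k = 1..2 * n. f k) = (\<Sum>m = 1..n. f (2 * m - 1) + f (2 * m))"
  for f :: "nat \<Rightarrow> 'a :: comm_monoid_add"
  by (induction n) (simp_all add: add.assoc)

text \<open>If \<open>qint (q ^ 4) k\<close> vanished, the geometric sum formula would make
  \<open>q\<close> a root of unity of order dividing \<open>4 * k\<close>.\<close>

lemma qfact_nonzero:
  assumes "generic q" shows "qfact (q ^ 4) n \<noteq> 0"
proof -
  have "qint (q ^ 4) k \<noteq> 0" if "k > 0" for k
  proof
    assume "qint (q ^ 4) k = 0"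
    then have "(q ^ 4) ^ k = 1"
      using one_diff_power_eq[of "q ^ 4" k] by (simp add: qint_def)
    then have "q ^ (4 * k) = 1" by (simp add: power_mult)
    then show False using assms that by (simp add: generic_def)
  qed
  then show ?thesis by (simp add: qfact_def)
qed

text \<open>Each column has a single nonzero entry, which reduces multiplication by
  \<open>JJ\<close> to one term. For \<open>m = 0\<close> truncated subtraction would make both
  column indices 0.\<close>

lemma JJ_columns:
  assumes "m \<ge> 1"
  shows "JJ v k (2 * m) = (if k = 2 * m - 1 then 1 else 0)"
    "JJ v k (2 * m - 1) = (if k = 2 * m then - v else 0)"
  using assms by (auto simp: JJ_def; presburger)+

lemma permutes_2_increasing: "{\<sigma>. \<sigma> permutes {1..2} \<and> \<sigma> 1 < \<sigma> (Suc 1)} = {id :: nat \<Rightarrow> nat}"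
proof -
  have "\<sigma> = id" if "\<sigma> permutes {1..2}" "\<sigma> 1 < \<sigma> (Suc 1)" for \<sigma> :: "nat \<Rightarrow> nat"
  proof
    fix k
    have "\<sigma> 1 \<in> {1..2}" "\<sigma> 2 \<in> {1..2}" using permutes_in_image[OF that(1)] by simp_all
    then have "\<sigma> 1 = 1" "\<sigma> 2 = 2" using that(2) by (auto simp: numeral_2_eq_2)
    then show "\<sigma> k = id k"
      using permutes_not_in[OF that(1), of k] by (cases "k = 1"; cases "k = 2") auto
  qed
  then show ?thesis by (auto simp: permutes_id)
qed

text \<open>The adjacent split with \<open>N = 2\<close> leaves only the identity.\<close>

lemma sum_permutes_2:
  "(\<Sum>\<sigma> | \<sigma> permutes {1..2}. scal (q ^ inv_number 2 \<sigma>) * prod_list (map (\<lambda>k. Y (\<sigma> k) k) [1..<2 + 1])) =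
    Y 1 1 * Y 2 2 + scal q * (Y 2 1 * Y 1 2)"
proof -
  have "(\<Sum>\<sigma> | \<sigma> permutes {1..2} \<and> True. scal (q ^ inv_number 2 \<sigma>) * (1 * (Y (\<sigma> 1) 1 * Y (\<sigma> (Suc 1)) 2 * 1))) =
      (\<Sum>\<sigma>\<in>{id}. scal (q ^ inv_number 2 \<sigma>) *
        (1 * ((Y (\<sigma> 1) 1 * Y (\<sigma> (Suc 1)) 2 + scal q * (Y (\<sigma> (Suc 1)) 1 * Y (\<sigma> 1) 2)) * 1)))"
    using sum_inversions_adjacent_split[where k = 1 and N = 2 and Q = "\<lambda>_. True" and L = "\<lambda>_. 1"
        and R = "\<lambda>_. 1" and g = "\<lambda>i j. Y i 1 * Y j 2" and q = q]
    unfolding simp_thms permutes_2_increasing by simp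
  then show ?thesis by (simp add: numeral_2_eq_2)
qed

lemma letter_in_free_algebra_le:
  "1 \<le> i \<Longrightarrow> i \<le> N \<Longrightarrow> 1 \<le> j \<Longrightarrow> j \<le> N \<Longrightarrow> letter i j \<in> carrier (free_algebra N)"
  by (simp add: letter_in_free_algebra)

text \<open>The literal matrix product gives the terms
  \<open>letter i (2 * m - 1) * letter j (2 * m)\<close> minus \<open>q\<close> times
  \<open>letter i (2 * m) * letter j (2 * m - 1)\<close>. The antidiagonal relation, available
  because \<open>i < j\<close>, reverses the second product and its sign, which yields the row
  pair.\<close>

lemma congruence_matrix_entry:
  fixes n :: nat and q :: complex
  defines "M \<equiv> qcoord q (- inverse q) (2 * n)"
    and "A \<equiv> qgen q (- inverse q) (2 * n)"
  defines "B \<equiv> mat_prod M (2 * n) (mat_prod M (2 * n) A (scalar_mat M (JJ q))) (mat_transpose A)"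
  assumes q: "q \<noteq> 0" and ij: "1 \<le> i" "i < j" "j \<le> 2 * n"
  shows "B i j = qideal q (- inverse q) (2 * n) +>\<^bsub>free_algebra (2 * n)\<^esub>
    (\<Sum>m\<in>{1..n}. row_pair q (2 * m - 1) (2 * m) i j)"
proof -
  let ?I = "qideal q (- inverse q) (2 * n)"
  let ?R = "free_algebra (2 * n)"
  let ?c = "\<lambda>f. ?I +>\<^bsub>?R\<^esub> f"
  interpret M: ring M unfolding M_def by (rule ring_qcoord)
  have let_cl: "letter i k \<in> carrier ?R" "letter j k \<in> carrier ?R" if "k \<in> {1..2 * n}" for k
    using that ij by (auto intro: letter_in_free_algebra_le)
  note cl = let_cl free_algebra_closed scalar_in_free_algebra
  \<comment> \<open>A representative in the free algebra of the entry in row \<open>i\<close> and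
    column \<open>k\<close> of the first product.\<close>
  define AJ where "AJ k = (\<Sum>l = 1..2 * n. letter i l * scal (JJ q l k))" for k
  have AJ_cl: "AJ k \<in> carrier ?R" for k
    unfolding AJ_def by (intro sum_in_free_algebra ballI cl)
  have "mat_prod M (2 * n) A (scalar_mat M (JJ q)) i k = ?c (AJ k)" for k
  proof -
    have "A i l \<otimes>\<^bsub>M\<^esub> scalar_mat M (JJ q) l k = ?c (letter i l * scal (JJ q l k))"
      if "l \<in> {1..2 * n}" for l
      unfolding A_def qgen_def scalar_mat_def M_def coset_one
      using that by (simp only: coset_smult coset_hom cl scalar_in_free_algebra[of 1, simplified] mult_1_right)
    then have "mat_prod M (2 * n) A (scalar_mat M (JJ q)) i k =
        (\<Oplus>\<^bsub>M\<^esub>l\<in>{1..2 * n}. ?c (letter i l * scal (JJ q l k)))"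
      unfolding mat_prod_def
      by (intro M.finsum_cong') (auto simp: M_def intro!: coset_closed cl)
    then show ?thesis
      unfolding M_def AJ_def by (simp only: coset_finsum[OF finite_atLeastAtMost] cl)
  qed
  then have "A' \<otimes>\<^bsub>M\<^esub> mat_transpose A k j = ?c (AJ k * letter j k)"
    if "k \<in> {1..2 * n}" "A' = mat_prod M (2 * n) A (scalar_mat M (JJ q)) i k" for k A'
    unfolding mat_transpose_def that(2) A_def qgen_def M_def
    using that(1) by (simp only: coset_hom cl AJ_cl)
  then have "B i j = (\<Oplus>\<^bsub>M\<^esub>k\<in>{1..2 * n}. ?c (AJ k * letter j k))"
    unfolding B_def mat_prod_def[of M "2 * n" "mat_prod M (2 * n) A (scalar_mat M (JJ q))"]
    by (intro M.finsum_cong') (auto simp: M_def intro!: coset_closed cl AJ_cl)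
  also have "\<dots> = ?c (\<Sum>k = 1..2 * n. AJ k * letter j k)"
    unfolding M_def by (intro coset_finsum finite_atLeastAtMost cl AJ_cl)
  also have "\<dots> = ?c (\<Sum>m\<in>{1..n}. row_pair q (2 * m - 1) (2 * m) i j)"
  proof (rule coset_eqI)
    have AJ: "AJ (2 * m) = letter i (2 * m - 1)" "AJ (2 * m - 1) = - (scal q * letter i (2 * m))"
      if "m \<in> {1..n}" for m
    proof -
      have *: "letter i l * scal (if l = l' then c else 0) = (if l = l' then scal c * letter i l' else 0)"
        for l l' c by (simp add: scal_commute)
      have "m \<ge> 1" "2 * m \<in> {1..2 * n}" "2 * m - 1 \<in> {1..2 * n}" using that by auto
      then show "AJ (2 * m) = letter i (2 * m - 1)" "AJ (2 * m - 1) = - (scal q * letter i (2 * m))"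
        unfolding AJ_def JJ_columns[OF \<open>m \<ge> 1\<close>] * by (simp_all add: scal_uminus del: atLeastAtMost_iff)
    qed
    have "(\<Sum>k = 1..2 * n. AJ k * letter j k) =
        (\<Sum>m = 1..n. letter i (2 * m - 1) * letter j (2 * m) -
          scal q * (letter i (2 * m) * letter j (2 * m - 1)))"
      unfolding sum_pairs by (rule sum.cong[OF refl]) (simp add: AJ mult.assoc del: One_nat_def)
    then have "(\<Sum>k = 1..2 * n. AJ k * letter j k) - (\<Sum>m\<in>{1..n}. row_pair q (2 * m - 1) (2 * m) i j) =
      - (\<Sum>m = 1..n. scal q * (letter i (2 * m) * letter j (2 * m - 1) +
          letter j (2 * m - 1) * letter i (2 * m)))"
      by (simp add: sum_subtractf[symmetric] sum_negf[symmetric] row_pair_def algebra_simps)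
    also have "\<dots> \<in> ?I"
      using ij by (intro falg.subspace_neg[OF qideal_subspace] falg.subspace_sum[OF qideal_subspace]
          relation_antidiagonal[OF q]) auto
    finally show "(\<Sum>k = 1..2 * n. AJ k * letter j k) -
      (\<Sum>m\<in>{1..n}. row_pair q (2 * m - 1) (2 * m) i j) \<in> ?I" .
    show "(\<Sum>m\<in>{1..n}. row_pair q (2 * m - 1) (2 * m) i j) \<in> carrier ?R"
      unfolding row_pair_def by (intro sum_in_free_algebra ballI cl) auto
  qed
  finally show ?thesis .
qed

theorem proposition3p7:
  fixes n :: nat and q :: complex
  assumes "n \<ge> 1" and "generic q"
  defines "M \<equiv> qcoord q (- inverse q) (2 * n)"
    and "A \<equiv> qgen q (- inverse q) (2 * n)"
  defines "B \<equiv> mat_prod M (2 * n) (mat_prod M (2 * n) A (scalar_mat M (JJ q))) (mat_transpose A)"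
  shows "qHf M q n B = qper M q (2 * n) A \<and>
    (\<forall>i j. 1 \<le> i \<and> i < j \<and> j \<le> 2 * n \<longrightarrow>
       B i j = (\<Oplus>\<^bsub>M\<^esub>m\<in>{1..n}. qper M q 2 (submatrix2 A i j (2 * m - 1) (2 * m))) \<and>
       B i j = (\<Oplus>\<^bsub>M\<^esub>m\<in>{1..n}.
                  A i (2 * m - 1) \<otimes>\<^bsub>M\<^esub> A j (2 * m) \<oplus>\<^bsub>M\<^esub>
                  q \<odot>\<^bsub>M\<^esub> (A j (2 * m - 1) \<otimes>\<^bsub>M\<^esub> A i (2 * m))))"
proof (intro conjI allI impI)
  let ?I = "qideal q (- inverse q) (2 * n)"
  let ?R = "free_algebra (2 * n)"
  let ?c = "\<lambda>f. ?I +>\<^bsub>?R\<^esub> f"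
  interpret M: ring M unfolding M_def by (rule ring_qcoord)
  have q: "q \<noteq> 0" using assms(2) by (simp add: generic_def)
  have A: "A = (\<lambda>i j. ?c (letter i j))" unfolding A_def qgen_def ..
  have entry: "B i j = ?c (\<Sum>m\<in>{1..n}. row_pair q (2 * m - 1) (2 * m) i j)"
    if "1 \<le> i" "i < j" "j \<le> 2 * n" for i j
    unfolding B_def A_def M_def by (rule congruence_matrix_entry[OF q that])
  note cl = letter_in_free_algebra_le free_algebra_closed scalar_in_free_algebra
  have row_pair_cl: "row_pair q (2 * m - 1) (2 * m) i j \<in> carrier ?R"
    if "1 \<le> i" "i < j" "j \<le> 2 * n" "m \<in> {1..n}" for i j m
    using that unfolding row_pair_def by (intro cl) auto
  {
    fix i j assume ij: "1 \<le> i \<and> i < j \<and> j \<le> 2 * n"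
    have "(\<Oplus>\<^bsub>M\<^esub>m\<in>{1..n}. ?c (row_pair q (2 * m - 1) (2 * m) i j)) =
        ?c (\<Sum>m\<in>{1..n}. row_pair q (2 * m - 1) (2 * m) i j)"
      unfolding M_def using ij by (intro coset_finsum row_pair_cl) auto
    then have "B i j = (\<Oplus>\<^bsub>M\<^esub>m\<in>{1..n}. ?c (row_pair q (2 * m - 1) (2 * m) i j))"
      using entry ij by simp
    moreover have "qper M q 2 (submatrix2 A i j (2 * m - 1) (2 * m)) =
        ?c (row_pair q (2 * m - 1) (2 * m) i j)" if "m \<in> {1..n}" for m
    proof -
      have "submatrix2 A i j (2 * m - 1) (2 * m) =
          (\<lambda>a b. ?c (submatrix2 letter i j (2 * m - 1) (2 * m) a b))"
        by (simp add: A submatrix2_def)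
      moreover have "submatrix2 letter i j (2 * m - 1) (2 * m) a b \<in> carrier ?R" for a b
        unfolding submatrix2_def using ij that by (intro cl) auto
      ultimately show ?thesis
        unfolding M_def using coset_qper[of 2 "submatrix2 letter i j (2 * m - 1) (2 * m)"]
        unfolding sum_permutes_2 by (simp add: submatrix2_def row_pair_def)
    qed
    moreover have "A i (2 * m - 1) \<otimes>\<^bsub>M\<^esub> A j (2 * m) \<oplus>\<^bsub>M\<^esub>
        q \<odot>\<^bsub>M\<^esub> (A j (2 * m - 1) \<otimes>\<^bsub>M\<^esub> A i (2 * m)) =
        ?c (row_pair q (2 * m - 1) (2 * m) i j)" if "m \<in> {1..n}" for m
    proof -
      have "letter i (2 * m - 1) \<in> carrier ?R" "letter j (2 * m) \<in> carrier ?R"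
        "letter j (2 * m - 1) \<in> carrier ?R" "letter i (2 * m) \<in> carrier ?R"
        using ij that by (auto intro!: cl)
      then show ?thesis
        unfolding A M_def row_pair_def
        by (simp only: coset_hom coset_smult free_algebra_closed scalar_in_free_algebra)
    qed
    ultimately show "B i j = (\<Oplus>\<^bsub>M\<^esub>m\<in>{1..n}. qper M q 2 (submatrix2 A i j (2 * m - 1) (2 * m)))"
      and "B i j = (\<Oplus>\<^bsub>M\<^esub>m\<in>{1..n}. A i (2 * m - 1) \<otimes>\<^bsub>M\<^esub> A j (2 * m) \<oplus>\<^bsub>M\<^esub>
          q \<odot>\<^bsub>M\<^esub> (A j (2 * m - 1) \<otimes>\<^bsub>M\<^esub> A i (2 * m)))"
      using ij row_pair_cl
      by (simp_all del: One_nat_def, intro M.finsum_cong'; simp add: M_def coset_closed)+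
  }
  \<comment> \<open>Splits each entry of \<open>B\<close> above the diagonal into
    \<open>h i j\<close> and \<open>q\<close> times \<open>h j i\<close>, the shape needed for
    \<open>hafnian_sum_unfold\<close>.\<close>
  define h where "h i j = (\<Sum>m\<in>{1..n}. letter i (2 * m - 1) * letter j (2 * m))" for i j
  have h: "(\<Sum>m\<in>{1..n}. row_pair q (2 * m - 1) (2 * m) i j) = h i j + scal q * h j i" for i j
    by (simp add: h_def row_pair_def sum.distrib sum_distrib_left)
  define H where "H = (\<Sum>\<sigma> | \<sigma> permutes {1..2 * n} \<and> (\<forall>i\<in>{1..n}. \<sigma> (2 * i - 1) < \<sigma> (2 * i)).
      scal (q ^ inv_number (2 * n) \<sigma>) * prod_list (map (\<lambda>i. h (\<sigma> (2 * i - 1)) (\<sigma> (2 * i)) +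
        scal q * h (\<sigma> (2 * i)) (\<sigma> (2 * i - 1))) [1..<n + 1]))"
  have "h i j + scal q * h j i \<in> carrier ?R" if "1 \<le> i" "i < j" "j \<le> 2 * n" for i j
    using row_pair_cl that unfolding h[symmetric] by (intro sum_in_free_algebra) blast
  from coset_qHf[where Y = "\<lambda>i j. h i j + scal q * h j i" and X = B and q = q, OF entry[unfolded h] this]
  have Hf: "qHf M q n B = ?c (scal (1 / qfact (q ^ 4) n) * H)"
    unfolding M_def H_def by blast
  \<comment> \<open>The column permanent of the increasing word is the usual permanent.\<close>
  have per_sum: "(\<Sum>\<sigma> | \<sigma> permutes {1..2 * n}. scal (q ^ inv_number (2 * n) \<sigma>) *
      prod_list (map (\<lambda>k. letter (\<sigma> k) k) [1..<2 * n + 1])) = col_per q [1..<2 * n + 1]"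
  proof -
    have "map2 letter (map \<sigma> ks) ks = map (\<lambda>k. letter (\<sigma> k) k) ks" for \<sigma> ks
      by (induction ks) simp_all
    then show ?thesis unfolding col_per_def by simp
  qed
  have per: "qper M q (2 * n) A = ?c (col_per q [1..<2 * n + 1])"
    unfolding A M_def per_sum[symmetric]
    by (rule coset_qper) (rule letter_in_free_algebra)
  have per_cl: "col_per q [1..<2 * n + 1] \<in> carrier ?R"
    unfolding per_sum[symmetric]
    by (intro sum_in_free_algebra ballI free_algebra_closed scalar_in_free_algebra prod_list_in_free_algebra)
      (auto intro!: letter_in_free_algebra dest: permutes_in_image simp del: upt_Suc)
  have "H - scal (qfact (q ^ 4) n) * col_per q [1..<2 * n + 1] \<in> ?I"
    using sum_col_per_pair_words[OF q, of n]
    unfolding sum_col_per_pair_words_eq_hafnian_sum H_def h_def .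
  \<comment> \<open>The normalisation of the Hafnian cancels the factorial, which is nonzero because
    \<open>q\<close> is generic.\<close>
  from falg.subspace_scale[OF qideal_subspace this, of "1 / qfact (q ^ 4) n"]
  have "scal (1 / qfact (q ^ 4) n) * H - col_per q [1..<2 * n + 1] \<in> ?I"
    using qfact_nonzero[OF assms(2), of n]
    by (simp add: right_diff_distrib mult.assoc[symmetric] mult_single del: upt_Suc)
  then show "qHf M q n B = qper M q (2 * n) A"
    unfolding Hf per by (rule coset_eqI[OF _ per_cl])
qed

end
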